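(* Let $f_0$ be a LICM function on $]0,\infty[$ that is not identically zero, let $\beta \ge 0$ be a real number, and let $f = f_0 + \beta\, u$, so that $\tilde f(p) = \tilde f_0(p) + \beta$ for $p>0$. Then there is a Bernstein function $h$ such that $$\frac{1}{p\,\tilde f(p)} = p\,\tilde h(p) \quad \text{for all } p>0 .$$ Moreover: (i) $0 < f_0(0) \le \infty$. If $\beta>0$ or $f_0$ is unbounded at $0$ (i.e. $f_0(0)=\infty$), then $h(0)=0$; otherwise $h(0)=1/f_0(0)$. (ii) The limit $f_\infty := \lim_{t\to\infty} f_0(t)$ exists and is non-negative. If $f_\infty>0$, then $h(t)\to 1/f_\infty$ as $t\to\infty$; otherwise $h(t)$ diverges to infinity as $t\to\infty$.
   Context: Notation: $[0,\infty[ = \{x\in\mathbf{R} : 0\le x<\infty\}$ and $]0,\infty[ = \{x\in\mathbf{R} : 0<x<\infty\}$. LICM (locally integrable completely monotone): an infinitely differentiable function $g$ on $]0,\infty[$ is LICM if $(-1)^n g^{(n)}(t)\ge 0$ for all $t>0$ and $n=0,1,2,\ldots$, and $g$ is integrable in a neighborhood of $0$. For such a function, $g(0)$ denotes $\lim_{t\to 0+} g(t)\in[0,\infty]$. Bernstein function: a function $h$ continuous on $[0,\infty[$ and infinitely differentiable on $]0,\infty[$ with $h(t)\ge 0$ and $(-1)^n h^{(n)}(t)\le 0$ for all $t>0$ and $n=1,2,\ldots$. Laplace transform: $\tilde g(p) = \int_0^\infty e^{-pt} g(t)\,dt$ for a locally integrable function $g$ whenever it exists; for LICM functions and Bernstein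 functions it exists for all $p>0$. The symbol $u$ denotes the identity of convolution: $u*g=g$ for every $g\in \mathcal{L}^1_{\mathrm{loc}}([0,\infty[)$, where $(f*g)(t)=\int_0^t f(s)g(t-s)\,ds$. It is identified with the identity operator on $\mathcal{L}^1_{\mathrm{loc}}([0,\infty[)$ and is assigned the Laplace transform $\tilde u(p)=1$. The expression $f_0+\beta u$ is understood as a convolution operator, with Laplace transform $\tilde f_0(p)+\beta$. *)

theory Defs
  imports "HOL-Analysis.Analysis"
begin

text \<open>
  Functions on the open half-line are represented by total functions on the reals.
  The values at non-positive arguments are irrelevant to \<open>smooth_pos\<close> and \<open>licm\<close>, since
  an iterated derivative at \<open>t > 0\<close> depends only on the germ at \<open>t\<close>; a Bernstein
  function also uses its value at 0, through continuity.
\<close>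

definition smooth_pos :: "(real \<Rightarrow> real) \<Rightarrow> bool" where
  "smooth_pos g \<longleftrightarrow> (\<forall>n. \<forall>t>0. (deriv ^^ n) g differentiable (at t))"

definition licm :: "(real \<Rightarrow> real) \<Rightarrow> bool" where
  "licm g \<longleftrightarrow> smooth_pos g \<and>
     (\<forall>n. \<forall>t>0. (-1) ^ n * (deriv ^^ n) g t \<ge> 0) \<and>
     (\<exists>e>0. set_integrable lborel {0<..<e} g)"

definition bernstein :: "(real \<Rightarrow> real) \<Rightarrow> bool" where
  "bernstein h \<longleftrightarrow> continuous_on {0..} h \<and> smooth_pos h \<and>
     (\<forall>t>0. h t \<ge> 0) \<and>
     (\<forall>n\<ge>1. \<forall>t>0. (-1) ^ n * (deriv ^^ n) h t \<le> 0)"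

text \<open>The value \<open>g(0)\<close> in \<open>[0, \<infinity>]\<close> is the right limit at 0, not the value of the total function.\<close>

definition value_at_0 :: "(real \<Rightarrow> real) \<Rightarrow> ereal" where
  "value_at_0 g = Lim (at_right 0) (\<lambda>t. ereal (g t))"

definition laplace_exists :: "(real \<Rightarrow> real) \<Rightarrow> real \<Rightarrow> bool" where
  "laplace_exists g p \<longleftrightarrow> set_integrable lborel {0<..} (\<lambda>t. exp (- p * t) * g t)"

definition laplace :: "(real \<Rightarrow> real) \<Rightarrow> real \<Rightarrow> real" where
  "laplace g p = (LINT t:{0<..}|lborel. exp (- p * t) * g t)"

definition convolution :: "(real \<Rightarrow> real) \<Rightarrow> (real \<Rightarrow> real) \<Rightarrow> real \<Rightarrow> real" where
  "convolution f g t = (LINT s:{0..t}|lborel. f s * g (t - s))"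

text \<open>
  \<open>Conv_Kernel g b\<close> stands for the formal sum \<open>g + b u\<close>, where \<open>u\<close> is the identity of
  convolution.  It is a convolution operator rather than a function, and its Laplace
  transform is assigned by the convention that \<open>u\<close> has transform 1.
\<close>

datatype conv_kernel = Conv_Kernel "real \<Rightarrow> real" real

primrec kernel_apply :: "conv_kernel \<Rightarrow> (real \<Rightarrow> real) \<Rightarrow> real \<Rightarrow> real" where
  "kernel_apply (Conv_Kernel g b) x t = convolution g x t + b * x t"

primrec kernel_laplace :: "conv_kernel \<Rightarrow> real \<Rightarrow> real" where
  "kernel_laplace (Conv_Kernel g b) p = laplace g p + b"

definition conv_unit :: conv_kernel where
  "conv_unit = Conv_Kernel (\<lambda>_. 0) 1"

lemma kernel_apply_conv_unit: "kernel_apply conv_unit x = x"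
  by (simp add: fun_eq_iff conv_unit_def convolution_def set_lebesgue_integral_def)

lemma kernel_laplace_conv_unit: "kernel_laplace conv_unit p = 1"
  by (simp add: conv_unit_def laplace_def set_lebesgue_integral_def)

end

theory Submission
  imports Defs "HOL-Complex_Analysis.Great_Picard"
begin

text \<open>
  The equation asks for a Bernstein function with transform \<open>1 / (p\<^sup>2 F(p))\<close>, where \<open>F\<close> is the transform
  of \<open>f0 + \<beta> u\<close>.  If \<open>f0\<close> is a finite sum of decaying exponentials and \<open>\<beta> > 0\<close>, this is elementary:
  \<open>F(p) = \<beta> + (\<Sum>a. w a / (p + a))\<close> is a rational function whose zeros interlace with its poles, so
  all residues of \<open>1 / (p F(p))\<close> are non-negative (\<open>reciprocal_partial_fractions\<close>), and each summand
  \<open>1 / (p + r)\<close> is \<open>p\<close> times the transform of the Bernstein function \<open>(1 - exp (- r t)) / r\<close>,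
  read as \<open>t\<close> when \<open>r = 0\<close>.

  The general case follows by two limits, both resting on one closure property: the functions
  \<open>\<lambda>p. p * laplace h p\<close> with \<open>h\<close> Bernstein are closed under pointwise limits on the positive half-line
  (\<open>bernstein_transform_limit\<close>).  This holds because a Bernstein function is increasing while
  \<open>h t / t\<close> is decreasing, and all its derivatives are bounded, locally on \<open>t > 0\<close>, by multiples
  of \<open>h t\<close>.  A bound at one point, which the transform supplies, therefore gives a subsequence that
  converges together with all derivatives, and the sign conditions survive in the limit.

  The first limit replaces exponential sums by a completely monotone function \<open>g\<close> shifted away from 0.
  The samples \<open>g (x + k \<delta>)\<close> form a completely monotone sequence; the weights of its Bernstein
  polynomials are non-negative and turn it, up to a small error, into a moment sequence of a finite
  measure on \<open>[0, 1]\<close>, which is the restriction of an exponential sum to the grid.  Monotonicity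
  controls the values between grid points (\<open>exponential_sums_converge\<close>).  This finite form of
  Bernstein's theorem avoids representing measures altogether.  The second limit removes the shift, and at the same time
  allows \<open>\<beta> = 0\<close> by approaching it from above.

  The values of \<open>h\<close> at 0 and at infinity are Abelian statements: as \<open>p\<close> tends to infinity (to 0),
  \<open>p * laplace h p\<close> tends to the value of \<open>h\<close> at 0 (at infinity), and likewise for \<open>f0\<close>.  Monotonicity turns
  each of these into explicit inequalities.
\<close>

section \<open>Iterated derivatives on the positive half-line\<close>

lemma smooth_pos_has_derivative:
  assumes "smooth_pos g" "t > 0"
  shows "((deriv ^^ n) g has_real_derivative (deriv ^^ Suc n) g t) (at t)"
proof -
  have "(deriv ^^ n) g field_differentiable at t"
    using assms unfolding smooth_pos_def
    by (simp add: real_differentiable_def field_differentiable_def)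
  then show ?thesis
    using field_differentiable_derivI by fastforce
qed

text \<open>
  Lets an explicit sequence \<open>D\<close> of successive derivatives stand in for the iterated operator \<open>deriv\<close>:
  agreement on the open half-line suffices, since a derivative only sees the germ.
\<close>

lemma iterated_deriv_eq:
  fixes g :: "real \<Rightarrow> real"
  assumes D: "\<And>n t. t > 0 \<Longrightarrow> (D n has_real_derivative D (Suc n) t) (at t)"
    and g: "\<And>t. t > 0 \<Longrightarrow> g t = D 0 t" and t: "t > 0"
  shows "(deriv ^^ n) g t = D n t"
  using t
proof (induction n arbitrary: t)
  case 0
  then show ?case by (simp add: g)
next
  case (Suc n)
  have "((deriv ^^ n) g has_real_derivative D (Suc n) t) (at t)"
    by (rule has_field_derivative_transform_within_open[OF D[of t n], where S = "{0<..}"])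
      (use Suc in auto)
  then show ?case by (simp add: DERIV_imp_deriv)
qed

lemma smooth_posI:
  fixes g :: "real \<Rightarrow> real"
  assumes D: "\<And>n t. t > 0 \<Longrightarrow> (D n has_real_derivative D (Suc n) t) (at t)"
    and g: "\<And>t. t > 0 \<Longrightarrow> g t = D 0 t"
  shows "smooth_pos g"
  unfolding smooth_pos_def
proof (intro allI impI)
  fix n and t :: real assume t: "t > 0"
  have "((deriv ^^ n) g has_real_derivative D (Suc n) t) (at t)"
    by (rule has_field_derivative_transform_within_open[OF D[of t n], where S = "{0<..}"])
      (use t iterated_deriv_eq[of D g, OF D g] in auto)
  then show "(deriv ^^ n) g differentiable at t"
    by (auto simp: real_differentiable_def)
qed

section \<open>Growth of Bernstein functions and of their derivatives\<close>

lemma bernsteinI: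
  assumes "\<And>n t. t > 0 \<Longrightarrow> (D n has_real_derivative D (Suc n) t) (at t)"
    and "\<And>t. t > 0 \<Longrightarrow> h t = D 0 t"
    and "continuous_on {0..} h"
    and "\<And>t. t > 0 \<Longrightarrow> D 0 t \<ge> 0"
    and "\<And>n t. n \<ge> 1 \<Longrightarrow> t > 0 \<Longrightarrow> (-1) ^ n * D n t \<le> 0"
  shows "bernstein h"
  using smooth_posI[of D h] iterated_deriv_eq[of D h] assms
  unfolding bernstein_def by auto

lemma bernstein_has_derivative:
  assumes "bernstein h" "t > 0"
  shows "((deriv ^^ n) h has_real_derivative (deriv ^^ Suc n) h t) (at t)"
  using assms smooth_pos_has_derivative unfolding bernstein_def by blast

lemma bernstein_mono:
  assumes h: "bernstein h" and st: "0 \<le> s" "s \<le> t"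
  shows "h s \<le> h t"
proof (rule DERIV_nonneg_imp_increasing_open[OF \<open>s \<le> t\<close>])
  fix x assume x: "s < x" "x < t"
  have "(-1) ^ 1 * (deriv ^^ 1) h x \<le> 0"
    using h x st unfolding bernstein_def by (metis le_refl order_le_less_trans)
  then show "\<exists>y. (h has_real_derivative y) (at x) \<and> 0 \<le> y"
    using bernstein_has_derivative[OF h, of x 0] x st by (intro exI[of _ "deriv h x"]) auto
next
  show "continuous_on {s..t} h"
    using h st unfolding bernstein_def by (auto elim: continuous_on_subset)
qed

lemma bernstein_nonneg:
  assumes h: "bernstein h" and t: "0 \<le> t"
  shows "h t \<ge> 0"
proof (cases "t = 0")
  case False
  with h t show ?thesis unfolding bernstein_def by auto
next
  case True
  have "(h \<longlongrightarrow> h 0) (at 0 within {0..})"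
    using h unfolding bernstein_def continuous_on_def by auto
  then have "(h \<longlongrightarrow> h 0) (at_right 0)"
    by (rule tendsto_within_subset) auto
  moreover have "\<forall>\<^sub>F x in at_right 0. h x \<ge> 0"
    using h unfolding bernstein_def by (auto simp: eventually_at_right_field intro: exI[of _ 1])
  ultimately show ?thesis
    using True by (auto intro: tendsto_lowerbound)
qed

text \<open>
  The next derivative has the opposite sign, so each derivative moves monotonically towards 0.
\<close>

lemma bernstein_deriv_antimono:
  assumes h: "bernstein h" and n: "n \<ge> 1" and st: "0 < s" "s \<le> t"
  shows "\<bar>(deriv ^^ n) h t\<bar> \<le> \<bar>(deriv ^^ n) h s\<bar>"
proof -
  have sgn: "(-1) ^ n * (deriv ^^ n) h x \<le> 0" if "x > 0" "n \<ge> 1" for x n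
    using h that unfolding bernstein_def by auto
  have abs: "\<bar>(deriv ^^ n) h x\<bar> = - ((-1) ^ n * (deriv ^^ n) h x)" if "x > 0" for x
    using sgn[OF that n] by (cases "even n") auto
  have "(-1) ^ n * (deriv ^^ n) h s \<le> (-1) ^ n * (deriv ^^ n) h t"
  proof (rule DERIV_nonneg_imp_nondecreasing[OF \<open>s \<le> t\<close>])
    fix x assume x: "s \<le> x" "x \<le> t"
    have "(-1) ^ n * (deriv ^^ Suc n) h x \<ge> 0"
      using sgn[of x "Suc n"] x st by auto
    then show "\<exists>y. ((\<lambda>a. (-1) ^ n * (deriv ^^ n) h a) has_real_derivative y) (at x) \<and> 0 \<le> y"
      using x st by (intro exI[of _ "(-1) ^ n * (deriv ^^ Suc n) h x"] conjI
          DERIV_cmult bernstein_has_derivative[OF h]) auto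
  qed
  then show ?thesis using abs st by auto
qed

text \<open>
  A derivative of constant sign and decreasing size at \<open>t\<close> is at most its average over \<open>[t/2, t]\<close>, which
  is a difference quotient of the preceding derivative.  Iterating this halves the argument each time.
\<close>

lemma bernstein_deriv_bound:
  assumes h: "bernstein h" and t: "t > 0"
  shows "\<bar>(deriv ^^ n) h t\<bar> \<le> (2 ^ n / t) ^ n * h t"
  using t
proof (induction n arbitrary: t)
  case 0
  then show ?case using bernstein_nonneg[OF h, of t] by auto
next
  case (Suc n)
  let ?g = "(deriv ^^ n) h"
  have "\<exists>z>t/2. z < t \<and> ?g t - ?g (t/2) = (t - t/2) * (deriv ^^ Suc n) h z"
    using Suc.prems by (intro MVT2 bernstein_has_derivative[OF h]) auto
  then obtain z where z: "t/2 < z" "z < t" "?g t - ?g (t/2) = t/2 * (deriv ^^ Suc n) h z"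
    by (auto simp: field_simps)
  have "\<bar>(deriv ^^ Suc n) h t\<bar> \<le> \<bar>(deriv ^^ Suc n) h z\<bar>"
    using z Suc.prems by (intro bernstein_deriv_antimono[OF h]) auto
  also have "\<dots> = 2 / t * \<bar>?g t - ?g (t/2)\<bar>"
  proof -
    have "\<bar>?g t - ?g (t/2)\<bar> = t/2 * \<bar>(deriv ^^ Suc n) h z\<bar>"
      unfolding z(3) using Suc.prems by (simp only: abs_mult)
    then show ?thesis using Suc.prems by (simp add: field_simps del: funpow.simps)
  qed
  also have "\<dots> \<le> 2 / t * ((2 ^ n / (t/2)) ^ n * h t)"
  proof (rule mult_left_mono)
    show "\<bar>?g t - ?g (t/2)\<bar> \<le> (2 ^ n / (t/2)) ^ n * h t"
    proof (cases "n = 0")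
      case True
      have "h (t/2) \<le> h t" "h (t/2) \<ge> 0"
        using Suc.prems bernstein_mono[OF h, of "t/2" t] bernstein_nonneg[OF h, of "t/2"] by auto
      then show ?thesis using True by auto
    next
      case False
      have s: "(-1) ^ n * ?g x \<le> 0" if "x > 0" for x
        using h that False unfolding bernstein_def by auto
      have "\<bar>?g t - ?g (t/2)\<bar> \<le> \<bar>?g (t/2)\<bar>"
        using bernstein_deriv_antimono[OF h, of n "t/2" t] False Suc.prems s[of t] s[of "t/2"]
        by (cases "even n") auto
      also have "\<dots> \<le> (2 ^ n / (t/2)) ^ n * h (t/2)"
        using Suc.IH[of "t/2"] Suc.prems by simp
      also have "\<dots> \<le> (2 ^ n / (t/2)) ^ n * h t"
        using Suc.prems by (intro mult_left_mono bernstein_mono[OF h]) auto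
      finally show ?thesis .
    qed
  qed (use Suc.prems in auto)
  also have "\<dots> = (2 * (2 * 2 ^ n) ^ n) / t ^ Suc n * h t"
    by (simp add: power_divide field_simps power_mult_distrib)
  also have "\<dots> \<le> (2 ^ Suc n / t) ^ Suc n * h t"
  proof (rule mult_right_mono)
    have "(2::real) * (2 * 2 ^ n) ^ n \<le> 2 ^ Suc n * (2 * 2 ^ n) ^ n"
      by (intro mult_right_mono) auto
    then show "2 * (2 * 2 ^ n) ^ n / t ^ Suc n \<le> (2 ^ Suc n / t) ^ Suc n"
      using Suc.prems by (simp add: power_divide divide_right_mono)
  qed (use Suc.prems bernstein_nonneg[OF h] in auto)
  finally show ?case .
qed

text \<open>
  Concavity together with \<open>h 0 \<ge> 0\<close> gives \<open>x * deriv h x \<le> h x\<close>, hence \<open>h x / x\<close> decreases.  With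
  monotonicity this confines \<open>h\<close> at one point by its value at another, uniformly over all Bernstein functions.
\<close>

lemma bernstein_ratio:
  assumes h: "bernstein h" and st: "0 < s" "s \<le> t"
  shows "h t \<le> (t / s) * h s"
proof -
  have "h t / t \<le> h s / s"
  proof (rule DERIV_nonpos_imp_nonincreasing[OF \<open>s \<le> t\<close>])
    fix x assume "s \<le> x" "x \<le> t"
    then have x: "x > 0" using st by auto
    have der: "(h has_real_derivative deriv h y) (at y)" if "y > 0" for y
      using bernstein_has_derivative[OF h that, of 0] by simp
    have "\<exists>z>0. z < x \<and> h x - h 0 = (x - 0) * deriv h z"
    proof -
      have "\<exists>l z. 0 < z \<and> z < x \<and> (h has_real_derivative l) (at z) \<and> h x - h 0 = (x - 0) * l"
      proof (rule MVT[OF x])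
        show "continuous_on {0..x} h"
          using h unfolding bernstein_def by (auto elim: continuous_on_subset)
      qed (use der real_differentiable_def in blast)
      then show ?thesis by (metis DERIV_unique der)
    qed
    then obtain z where z: "0 < z" "z < x" "h x - h 0 = x * deriv h z" by auto
    have pos: "deriv h y \<ge> 0" if "y > 0" for y
    proof -
      have "(-1) ^ 1 * (deriv ^^ 1) h y \<le> 0"
        using h that unfolding bernstein_def by blast
      then show ?thesis by simp
    qed
    have "deriv h x \<le> deriv h z"
      using bernstein_deriv_antimono[OF h, of 1 z x] z pos[of x] pos[of z] by auto
    then have "x * deriv h x \<le> x * deriv h z" using x by simp
    also have "\<dots> \<le> h x" using z bernstein_nonneg[OF h, of 0] by simp
    finally have le: "x * deriv h x \<le> h x" .
    show "\<exists>y. ((\<lambda>x. h x / x) has_real_derivative y) (at x) \<and> y \<le> 0"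
      using x le
      by (intro exI[of _ "(deriv h x * x - h x * 1) / (x * x)"] conjI DERIV_divide der DERIV_ident)
        (auto simp: field_simps)
  qed
  then show ?thesis using st by (simp add: field_simps)
qed

lemma bernstein_linear_bound:
  assumes h: "bernstein h" and "t > 0" "0 < d"
  shows "h t \<le> h d * (1 + t / d)"
proof (cases "t \<le> d")
  case True
  have "h t \<le> h d" using assms True by (intro bernstein_mono[OF h]) auto
  also have "\<dots> \<le> h d * (1 + t / d)"
    using mult_left_mono[of 1 "1 + t/d" "h d"] assms bernstein_nonneg[OF h, of d] by auto
  finally show ?thesis .
next
  case False
  have "h t \<le> (t / d) * h d" using assms False by (intro bernstein_ratio[OF h]) auto
  also have "\<dots> \<le> h d * (1 + t / d)"
    using bernstein_nonneg[OF h, of d] assms by (simp add: algebra_simps)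
  finally show ?thesis .
qed

text \<open>
  Uniform bounds on second derivatives make the difference quotients of \<open>f m\<close> approach \<open>f' m t\<close> at a rate
  independent of \<open>m\<close>.  So convergence of the functions forces convergence of the derivatives, and the
  same rate passes to the limit function.
\<close>

lemma derivative_of_pointwise_limit:
  fixes f f' f'' :: "nat \<Rightarrow> real \<Rightarrow> real"
  assumes f: "\<And>m t. t > 0 \<Longrightarrow> (f m has_real_derivative f' m t) (at t)"
    and f': "\<And>m t. t > 0 \<Longrightarrow> (f' m has_real_derivative f'' m t) (at t)"
    and bound: "\<And>a. a > 0 \<Longrightarrow> \<exists>B. \<forall>m. \<forall>t\<ge>a. \<bar>f'' m t\<bar> \<le> B"
    and lim: "\<And>t. t > 0 \<Longrightarrow> (\<lambda>m. f m t) \<longlonglongrightarrow> F t"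
    and t: "t > 0"
  shows "convergent (\<lambda>m. f' m t) \<and> (F has_real_derivative lim (\<lambda>m. f' m t)) (at t)"
proof -
  obtain B0 where B0: "\<And>m s. s \<ge> t/2 \<Longrightarrow> \<bar>f'' m s\<bar> \<le> B0"
    using bound[of "t/2"] t by auto
  define B where "B = \<bar>B0\<bar> + 1"
  have B: "\<bar>f'' m s\<bar> \<le> B" if "s \<ge> t/2" for m s
    using B0[OF that, of m] by (simp add: B_def)
  have Bpos: "B > 0" by (simp add: B_def)
  have lip: "\<bar>f' m x - f' m y\<bar> \<le> B * \<bar>x - y\<bar>" if "x \<ge> t/2" "y \<ge> t/2" for m x y
  proof -
    have "norm (f' m x - f' m y) \<le> B * norm (x - y)"
    proof (rule field_differentiable_bound[where S = "{t/2..}"])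
      fix z assume "z \<in> {t/2..}"
      then have z: "z > 0" "z \<ge> t/2" using t by auto
      show "(f' m has_field_derivative f'' m z) (at z within {t/2..})"
        using f'[OF z(1)] by (rule has_field_derivative_at_within)
      show "norm (f'' m z) \<le> B" using B[OF z(2)] by simp
    qed (use that in auto)
    then show ?thesis by simp
  qed
  have quot: "\<bar>(f m (t + s) - f m t) / s - f' m t\<bar> \<le> B * \<bar>s\<bar>"
    if s: "s \<noteq> 0" "\<bar>s\<bar> < t/2" for m s
  proof -
    have "\<exists>\<xi>. \<bar>\<xi> - t\<bar> \<le> \<bar>s\<bar> \<and> f m (t + s) - f m t = s * f' m \<xi>"
    proof (cases "s > 0")
      case True
      have "\<exists>z>t. z < t + s \<and> f m (t + s) - f m t = (t + s - t) * f' m z"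
        using True t by (intro MVT2 f) auto
      then obtain z where "t < z" "z < t + s" "f m (t + s) - f m t = s * f' m z"
        by auto
      then show ?thesis by (intro exI[of _ z]) auto
    next
      case False
      have "\<exists>z>t+s. z < t \<and> f m t - f m (t + s) = (t - (t + s)) * f' m z"
        using False s t by (intro MVT2 f) auto
      then obtain z where "t + s < z" "z < t" "f m t - f m (t + s) = (t - (t + s)) * f' m z"
        by auto
      then show ?thesis by (intro exI[of _ z]) auto
    qed
    then obtain \<xi> where \<xi>: "\<bar>\<xi> - t\<bar> \<le> \<bar>s\<bar>" "f m (t + s) - f m t = s * f' m \<xi>" by auto
    have "(f m (t + s) - f m t) / s - f' m t = f' m \<xi> - f' m t"
      using \<xi> s by simp
    also have "\<bar>\<dots>\<bar> \<le> B * \<bar>\<xi> - t\<bar>" using \<xi> s t by (intro lip) (auto simp: abs_if split: if_splits)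
    also have "\<dots> \<le> B * \<bar>s\<bar>" using \<xi> Bpos by simp
    finally show ?thesis .
  qed
  have "Cauchy (\<lambda>m. f' m t)"
  proof (rule metric_CauchyI)
    fix e :: real assume e: "e > 0"
    define s where "s = min (t/4) (e / (4 * B))"
    have s: "s \<noteq> 0" "\<bar>s\<bar> < t/2" "s > 0" "B * \<bar>s\<bar> \<le> e/4"
      using t e Bpos by (auto simp: s_def min_def field_simps)
    have "Cauchy (\<lambda>m. (f m (t + s) - f m t) / s)"
      using s t by (intro LIMSEQ_imp_Cauchy[of _ "(F (t + s) - F t) / s"] tendsto_intros lim) auto
    from metric_CauchyD[OF this, of "e/4"] e
    obtain M where M: "\<And>m n. m \<ge> M \<Longrightarrow> n \<ge> M \<Longrightarrow>
        \<bar>(f m (t + s) - f m t) / s - (f n (t + s) - f n t) / s\<bar> < e/4"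
      unfolding dist_real_def by auto
    show "\<exists>M. \<forall>m\<ge>M. \<forall>n\<ge>M. dist (f' m t) (f' n t) < e"
    proof (intro exI[of _ M] allI impI)
      fix m n assume "m \<ge> M" "n \<ge> M"
      then show "dist (f' m t) (f' n t) < e"
        using M[of m n] quot[OF s(1,2), of m] quot[OF s(1,2), of n] s(4) e
        unfolding dist_real_def by linarith
    qed
  qed
  then have conv: "convergent (\<lambda>m. f' m t)" by (simp add: Cauchy_convergent_iff)
  then have L: "(\<lambda>m. f' m t) \<longlonglongrightarrow> lim (\<lambda>m. f' m t)" by (simp add: convergent_LIMSEQ_iff)
  have quotF: "\<bar>(F (t + s) - F t) / s - lim (\<lambda>m. f' m t)\<bar> \<le> B * \<bar>s\<bar>"
    if s: "s \<noteq> 0" "\<bar>s\<bar> < t/2" for s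
  proof (rule LIMSEQ_le_const2)
    show "(\<lambda>m. \<bar>(f m (t + s) - f m t) / s - f' m t\<bar>)
        \<longlonglongrightarrow> \<bar>(F (t + s) - F t) / s - lim (\<lambda>m. f' m t)\<bar>"
      using s t by (intro tendsto_intros lim L) auto
  qed (use quot[OF s] in auto)
  have "((\<lambda>s. (F (t + s) - F t) / s - lim (\<lambda>m. f' m t)) \<longlongrightarrow> 0) (at 0)"
  proof (rule Lim_null_comparison)
    show "\<forall>\<^sub>F s in at 0. norm ((F (t + s) - F t) / s - lim (\<lambda>m. f' m t)) \<le> B * \<bar>s\<bar>"
      unfolding eventually_at by (rule exI[of _ "t/2"]) (use t quotF in \<open>auto simp: dist_real_def\<close>)
    show "((\<lambda>s. B * \<bar>s\<bar>) \<longlongrightarrow> 0) (at 0)"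
      by (auto intro!: tendsto_eq_intros)
  qed
  then have "(F has_real_derivative lim (\<lambda>m. f' m t)) (at t)"
    unfolding DERIV_def by (simp add: LIM_zero_iff)
  with conv show ?thesis by blast
qed

section \<open>Reciprocals of simple partial fractions\<close>

lemma degree_prod_linear:
  "finite A \<Longrightarrow> degree (\<Prod>a\<in>A. [:- f a, 1::real:]) = card A"
  by (subst degree_prod_eq_sum_degree) auto

lemma lead_coeff_prod_linear:
  "lead_coeff (\<Prod>a\<in>A. [:- f a, 1::real:]) = 1"
  by (simp add: lead_coeff_prod)

lemma poly_prod_linear: "poly (\<Prod>a\<in>A. [:- f a, 1::real:]) x = (\<Prod>a\<in>A. x - f a)"
  by (simp add: poly_prod)

text \<open>
  Lagrange interpolation of \<open>P\<close> at the nodes \<open>R\<close> reproduces \<open>P\<close>, because its degree is below the number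
  of nodes; dividing by the node polynomial gives the partial fractions.
\<close>

lemma lagrange_partial_fractions:
  fixes P :: "real poly"
  assumes R: "finite R" and deg: "degree P < card R" and x: "x \<notin> R"
  shows "poly P x / (\<Prod>s\<in>R. x - s)
    = (\<Sum>r\<in>R. poly P r / (\<Prod>s\<in>R - {r}. r - s) / (x - r))"
proof -
  define c where "c r = poly P r / (\<Prod>s\<in>R - {r}. r - s)" for r
  define Q where "Q = (\<Sum>r\<in>R. smult (c r) (\<Prod>s\<in>R - {r}. [:- s, 1:]))"
  have "P = Q"
  proof (rule poly_eqI_degree[where A = R])
    fix y assume y: "y \<in> R"
    have "poly Q y = (\<Sum>r\<in>R. c r * (\<Prod>s\<in>R - {r}. y - s))"
      by (simp add: Q_def poly_sum poly_prod)
    also have "\<dots> = (\<Sum>r\<in>R. if r = y then poly P y else 0)"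
    proof (rule sum.cong)
      fix r assume r: "r \<in> R"
      show "c r * (\<Prod>s\<in>R - {r}. y - s) = (if r = y then poly P y else 0)"
      proof (cases "r = y")
        case True
        have "(\<Prod>s\<in>R - {y}. y - s) \<noteq> 0" using R by auto
        then show ?thesis using True by (simp add: c_def)
      next
        case False
        then show ?thesis using R y by auto
      qed
    qed simp
    also have "\<dots> = poly P y" using R y by simp
    finally show "poly P y = poly Q y" by simp
  next
    have "degree Q \<le> card R - 1"
      unfolding Q_def
    proof (rule degree_sum_le[OF R])
      fix r assume "r \<in> R"
      then show "degree (smult (c r) (\<Prod>s\<in>R - {r}. [:- s, 1:])) \<le> card R - 1"
        using R degree_smult_le[of "c r" "\<Prod>s\<in>R - {r}. [:- s, 1:]"]
          degree_prod_linear[of "R - {r}" "\<lambda>s. s"] by simp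
    qed
    then show "degree Q < card R" using deg by linarith
  qed (rule deg)
  then have "poly P x / (\<Prod>s\<in>R. x - s) = (\<Sum>r\<in>R. c r * (\<Prod>s\<in>R - {r}. x - s) / (\<Prod>s\<in>R. x - s))"
    by (simp add: Q_def poly_sum poly_prod sum_divide_distrib)
  also have "\<dots> = (\<Sum>r\<in>R. c r / (x - r))"
  proof (rule sum.cong)
    fix r assume r: "r \<in> R"
    have "(\<Prod>s\<in>R. x - s) = (x - r) * (\<Prod>s\<in>R - {r}. x - s)"
      using R r by (rule prod.remove)
    moreover have "(\<Prod>s\<in>R - {r}. x - s) \<noteq> 0" using R x by auto
    ultimately show "c r * (\<Prod>s\<in>R - {r}. x - s) / (\<Prod>s\<in>R. x - s) = c r / (x - r)"
      by simp
  qed simp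
  finally show ?thesis by (simp add: c_def)
qed

text \<open>
  The polynomial \<open>q\<close> is the numerator of \<open>\<beta> - (\<Sum>c\<in>A. w c / (x - c))\<close>, that is of
  \<open>\<beta> + (\<Sum>a\<in>A. w a / (p + a))\<close> in the variable \<open>x = - p\<close>.  At consecutive poles it takes opposite signs,
  and beyond the last pole it changes from negative to positive, so every pole is followed by a zero
  before the next one.
\<close>

lemma interlacing_zeros:
  fixes A :: "real set"
  assumes A: "finite A" and w: "\<And>a. a \<in> A \<Longrightarrow> w a > 0" and \<beta>: "\<beta> > 0"
  defines "q \<equiv> smult \<beta> (\<Prod>c\<in>A. [:- c, 1:]) - (\<Sum>c\<in>A. smult (w c) (\<Prod>d\<in>A - {c}. [:- d, 1:]))"
  shows "degree q \<le> card A" "coeff q (card A) = \<beta>"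
    "\<exists>r. \<forall>a\<in>A. a < r a \<and> poly q (r a) = 0 \<and> (\<forall>b\<in>A. a < b \<longrightarrow> r a < b)"
proof -
  let ?S = "\<Sum>c\<in>A. smult (w c) (\<Prod>d\<in>A - {c}. [:- d, 1:])"
  have dS: "degree (smult (w c) (\<Prod>d\<in>A - {c}. [:- d, 1:])) < card A" if "c \<in> A" for c
    using that A degree_smult_le[of "w c" "\<Prod>d\<in>A - {c}. [:- d, 1:]"]
      degree_prod_linear[of "A - {c}" "\<lambda>s. s"] card_gt_0_iff[of A] by auto
  have dP: "degree (\<Prod>c\<in>A. [:- c, 1:]) = card A"
    using degree_prod_linear[OF A, of "\<lambda>s. s"] by simp
  have cS: "coeff ?S (card A) = 0"
    unfolding coeff_sum using dS by (intro sum.neutral ballI coeff_eq_0)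
  have cP: "coeff (\<Prod>c\<in>A. [:- c, 1:]) (card A) = 1"
    using lead_coeff_prod_linear[of "\<lambda>s. s" A] dP by simp
  show dq: "degree q \<le> card A"
    unfolding q_def
  proof (rule degree_diff_le)
    show "degree ?S \<le> card A"
      by (rule degree_sum_le[OF A]) (rule less_imp_le, rule dS)
  qed (use dP in simp)
  show cq: "coeff q (card A) = \<beta>"
    unfolding q_def by (simp add: cS cP)
  have lc: "lead_coeff q = \<beta>"
    using dq cq \<beta> le_degree[of q "card A"] by force
  have pq: "poly q a = - w a * (\<Prod>d\<in>A - {a}. a - d)" if a: "a \<in> A" for a
  proof -
    have "poly ?S a = (\<Sum>c\<in>A. if c = a then w a * (\<Prod>d\<in>A - {a}. a - d) else 0)"
      unfolding poly_sum
    proof (rule sum.cong)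
      fix c assume c: "c \<in> A"
      show "poly (smult (w c) (\<Prod>d\<in>A - {c}. [:- d, 1:])) a
        = (if c = a then w a * (\<Prod>d\<in>A - {a}. a - d) else 0)"
        using A a by (auto simp: poly_prod)
    qed simp
    also have "\<dots> = w a * (\<Prod>d\<in>A - {a}. a - d)" using A a by simp
    finally show ?thesis using A a by (auto simp: q_def poly_prod)
  qed
  have ex: "\<exists>r>a. poly q r = 0 \<and> (\<forall>b\<in>A. a < b \<longrightarrow> r < b)" if a: "a \<in> A" for a
  proof (cases "\<exists>b\<in>A. a < b")
    case True
    define b where "b = Min {b \<in> A. a < b}"
    have "b \<in> {b \<in> A. a < b}" unfolding b_def using True A by (intro Min_in) auto
    then have b: "b \<in> A" "a < b" by auto
    have bmin: "b \<le> c" if "c \<in> A" "a < c" for c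
      unfolding b_def using that A by (intro Min_le) auto
    have e1: "(\<Prod>d\<in>A - {a}. a - d) = (a - b) * (\<Prod>d\<in>A - {a} - {b}. a - d)"
      using A a b by (intro prod.remove) auto
    have e2: "(\<Prod>d\<in>A - {b}. b - d) = (b - a) * (\<Prod>d\<in>A - {b} - {a}. b - d)"
      using A a b by (intro prod.remove) auto
    have e3: "A - {b} - {a} = A - {a} - {b}" by auto
    have "poly q a * poly q b
        = w a * w b * ((a - b) * (b - a)) * (\<Prod>d\<in>A - {a} - {b}. (a - d) * (b - d))"
      unfolding pq[OF a] pq[OF b(1)] e1 e2 e3 prod.distrib by algebra
    \<comment> \<open>No pole lies between the neighbours \<open>a\<close> and \<open>b\<close>, so all these factors are positive.\<close>
    moreover have "(\<Prod>d\<in>A - {a} - {b}. (a - d) * (b - d)) > 0"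
    proof (rule prod_pos)
      fix d assume d: "d \<in> A - {a} - {b}"
      then have "d < a \<or> b < d" using bmin[of d] by force
      then show "(a - d) * (b - d) > 0"
        using b by (auto intro: mult_pos_pos mult_neg_neg)
    qed
    moreover have "(a - b) * (b - a) < 0" using b by (intro mult_neg_pos) auto
    ultimately have "poly q a * poly q b < 0"
      using w[OF a] w[OF b(1)] by (simp add: mult_less_0_iff zero_less_mult_iff)
    then obtain r where "a < r" "r < b" "poly q r = 0"
      using poly_IVT[OF b(2)] by auto
    then show ?thesis using bmin by force
  next
    case False
    have "(\<Prod>d\<in>A - {a}. a - d) > 0"
      using False by (intro prod_pos) force
    then have neg: "poly q a < 0" using pq[OF a] w[OF a] by simp
    obtain n where n: "\<And>x. x \<ge> n \<Longrightarrow> poly q x \<ge> lead_coeff q"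
      using poly_pinfty_gt_lc[of q] lc \<beta> by auto
    have "poly q (max n (a + 1)) > 0" using n[of "max n (a + 1)"] lc \<beta> by simp
    moreover have "a < max n (a + 1)" by simp
    ultimately obtain r where "a < r" "poly q r = 0"
      using poly_IVT_pos[of a "max n (a + 1)" q] neg by blast
    then show ?thesis using False by auto
  qed
  show "\<exists>r. \<forall>a\<in>A. a < r a \<and> poly q (r a) = 0 \<and> (\<forall>b\<in>A. a < b \<longrightarrow> r a < b)"
    by (rule bchoice) (use ex in auto)
qed

text \<open>
  With the zeros \<open>r a\<close> of \<open>q\<close>, the reciprocal has the simple poles 0 and \<open>- r a\<close>, and up to the factor
  \<open>1 / \<beta>\<close> its residues are products of quotients such as \<open>(r a - b) / (r a - r b)\<close>.  Interlacing makes
  the numerator and the denominator of each quotient agree in sign.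
\<close>

lemma reciprocal_partial_fractions:
  fixes A :: "real set"
  assumes A: "finite A" and A0: "\<And>a. a \<in> A \<Longrightarrow> a \<ge> 0"
    and w: "\<And>a. a \<in> A \<Longrightarrow> w a > 0" and \<beta>: "\<beta> > 0"
  shows "\<exists>R c. finite R \<and> (\<forall>r\<in>R. r \<ge> 0 \<and> c r \<ge> 0) \<and>
    (\<forall>p>0. 1 / (p * (\<beta> + (\<Sum>a\<in>A. w a / (p + a)))) = (\<Sum>r\<in>R. c r / (p + r)))"
proof -
  define P where "P = (\<Prod>c\<in>A. [:- c, 1::real:])"
  define q where "q = smult \<beta> P - (\<Sum>c\<in>A. smult (w c) (\<Prod>d\<in>A - {c}. [:- d, 1:]))"
  have zeros: "degree q \<le> card A" "coeff q (card A) = \<beta>"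
    "\<exists>r. \<forall>a\<in>A. a < r a \<and> poly q (r a) = 0 \<and> (\<forall>b\<in>A. a < b \<longrightarrow> r a < b)"
    using interlacing_zeros[of A w \<beta>] A w \<beta> unfolding P_def q_def by blast+
  obtain r where "\<forall>a\<in>A. a < r a \<and> poly q (r a) = 0 \<and> (\<forall>b\<in>A. a < b \<longrightarrow> r a < b)"
    using zeros(3) by blast
  then have r: "\<And>a. a \<in> A \<Longrightarrow> a < r a" "\<And>a. a \<in> A \<Longrightarrow> poly q (r a) = 0"
    "\<And>a b. a \<in> A \<Longrightarrow> b \<in> A \<Longrightarrow> a < b \<Longrightarrow> r a < b" by auto
  have inj: "inj_on r A"
  proof (rule inj_onI, rule ccontr)
    fix a b assume "a \<in> A" "b \<in> A" "r a = r b" "a \<noteq> b"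
    then show False using r(1)[of a] r(1)[of b] r(3)[of a b] r(3)[of b a] by linarith
  qed
  have rpos: "r a > 0" if "a \<in> A" for a using r(1)[OF that] A0[OF that] by simp
  \<comment> \<open>The zeros found are as many as the degree, so they are all zeros of \<open>q\<close>.\<close>
  have qeq: "q = smult \<beta> (\<Prod>a\<in>A. [:- r a, 1:])"
  proof (rule poly_eqI_degree_lead_coeff[where n = "card A" and A = "r ` A"])
    show "coeff q (card A) = coeff (smult \<beta> (\<Prod>a\<in>A. [:- r a, 1:])) (card A)"
      using zeros(2) lead_coeff_prod_linear[of r A] degree_prod_linear[OF A, of r] by simp
    show "card A \<le> card (r ` A)" using inj by (simp add: card_image)
    show "degree (smult \<beta> (\<Prod>a\<in>A. [:- r a, 1:])) \<le> card A"
      using degree_prod_linear[OF A, of r] by simp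
    fix z assume "z \<in> r ` A"
    then show "poly q z = poly (smult \<beta> (\<Prod>a\<in>A. [:- r a, 1:])) z"
      using r(2) A by (auto simp: poly_prod)
  qed (use zeros(1) in auto)
  define R where "R = insert 0 (r ` A)"
  have R: "finite R" using A by (simp add: R_def)
  have R0: "0 \<notin> r ` A" using rpos by force
  have cardR: "card R = Suc (card A)"
    using A R0 inj by (simp add: R_def card_image)
  define c where "c s = poly P s / (\<Prod>u\<in>R - {s}. s - u) / \<beta>" for s
  have cpos: "c s \<ge> 0" if s: "s \<in> R" for s
  proof -
    consider "s = 0" | a where "a \<in> A" "s = r a" using s by (auto simp: R_def)
    then have "poly P s / (\<Prod>u\<in>R - {s}. s - u) \<ge> 0"
    proof cases
      case 1
      have "R - {0} = r ` A" using R0 by (auto simp: R_def)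
      then have "poly P s / (\<Prod>u\<in>R - {s}. s - u) = (\<Prod>a\<in>A. (- a) / (- r a))"
        using 1 inj unfolding P_def poly_prod by (simp only: prod.reindex prod_dividef) simp
      also have "\<dots> \<ge> 0"
        using A0 rpos by (intro prod_nonneg) (auto intro: divide_nonneg_nonneg less_imp_le)
      finally show ?thesis .
    next
      case 2
      have "R - {s} = insert 0 (r ` (A - {a}))"
        using 2 R0 inj by (auto simp: R_def inj_on_def)
      moreover have "0 \<notin> r ` (A - {a})" using R0 by auto
      moreover have "inj_on r (A - {a})" using inj by (rule inj_on_subset) auto
      ultimately have "(\<Prod>u\<in>R - {s}. s - u) = s * (\<Prod>b\<in>A - {a}. s - r b)"
        using A by (simp add: prod.reindex)
      moreover have "poly P s = (s - a) * (\<Prod>b\<in>A - {a}. s - b)"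
        unfolding P_def poly_prod using A 2(1) by (subst prod.remove[of A a]) auto
      ultimately have "poly P s / (\<Prod>u\<in>R - {s}. s - u)
          = (s - a) / s * (\<Prod>b\<in>A - {a}. (s - b) / (s - r b))"
        by (simp add: prod_dividef)
      also have "\<dots> \<ge> 0"
      proof (intro mult_nonneg_nonneg prod_nonneg)
        show "(s - a) / s \<ge> 0" using r(1)[of a] rpos[of a] 2 by simp
        fix b assume b: "b \<in> A - {a}"
        show "(s - b) / (s - r b) \<ge> 0"
        proof (cases "b < a")
          case True
          then show ?thesis using r(1)[of a] r(3)[of b a] b 2 by simp
        next
          case False
          then show ?thesis using r(1)[of b] r(3)[of a b] b 2 by (simp add: divide_nonpos_nonpos)
        qed
      qed
      finally show ?thesis .
    qed
    then show ?thesis using \<beta> unfolding c_def by (rule divide_nonneg_pos)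
  qed
  have "1 / (p * (\<beta> + (\<Sum>a\<in>A. w a / (p + a)))) = (\<Sum>s\<in>R. c s / (p + s))" if p: "p > 0" for p
  proof -
    define x where "x = - p"
    have xA: "x \<noteq> a" if "a \<in> A" for a using A0[OF that] p by (simp add: x_def)
    have xR: "x \<notin> R" using rpos p by (force simp: R_def x_def)
    have Px: "poly P x \<noteq> 0" using A xA by (auto simp: P_def poly_prod)
    have "poly q x / poly P x = \<beta> - (\<Sum>a\<in>A. w a * (\<Prod>d\<in>A - {a}. x - d) / (\<Prod>d\<in>A. x - d))"
      using Px by (simp add: q_def diff_divide_distrib poly_sum sum_divide_distrib poly_prod P_def)
    also have "(\<Sum>a\<in>A. w a * (\<Prod>d\<in>A - {a}. x - d) / (\<Prod>d\<in>A. x - d)) = (\<Sum>a\<in>A. w a / (x - a))"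
    proof (rule sum.cong)
      fix a assume a: "a \<in> A"
      have "(\<Prod>d\<in>A. x - d) = (x - a) * (\<Prod>d\<in>A - {a}. x - d)"
        using A a by (rule prod.remove)
      moreover have "(\<Prod>d\<in>A - {a}. x - d) \<noteq> 0" using A xA by auto
      ultimately show "w a * (\<Prod>d\<in>A - {a}. x - d) / (\<Prod>d\<in>A. x - d) = w a / (x - a)" by simp
    qed simp
    also have "(\<Sum>a\<in>A. w a / (x - a)) = - (\<Sum>a\<in>A. w a / (p + a))"
      unfolding sum_negf[symmetric] minus_divide_right by (simp add: x_def)
    finally have G: "\<beta> + (\<Sum>a\<in>A. w a / (p + a)) = poly q x / poly P x" by simp
    have "(\<Prod>s\<in>R. x - s) = x * (\<Prod>a\<in>A. x - r a)"
      using R0 A inj by (simp add: R_def prod.reindex)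
    moreover have "p = - x" by (simp add: x_def)
    ultimately have "p * poly q x = - \<beta> * (\<Prod>s\<in>R. x - s)"
      unfolding qeq poly_smult poly_prod_linear by simp
    then have "1 / (p * (\<beta> + (\<Sum>a\<in>A. w a / (p + a)))) = - (1 / \<beta>) * (poly P x / (\<Prod>s\<in>R. x - s))"
      unfolding G by simp
    also have "poly P x / (\<Prod>s\<in>R. x - s) = (\<Sum>s\<in>R. poly P s / (\<Prod>u\<in>R - {s}. s - u) / (x - s))"
      using R xR cardR degree_prod_linear[OF A, of "\<lambda>s. s"]
      by (intro lagrange_partial_fractions) (auto simp: P_def)
    also have "- (1 / \<beta>) * \<dots> = (\<Sum>s\<in>R. c s / (p + s))"
      unfolding sum_distrib_left
    proof (rule sum.cong)
      fix s assume s: "s \<in> R"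
      have "x - s = - (p + s)" by (simp add: x_def)
      then show "- (1 / \<beta>) * (poly P s / (\<Prod>u\<in>R - {s}. s - u) / (x - s)) = c s / (p + s)"
        unfolding c_def by (simp only: divide_minus_right) simp
    qed simp
    finally show ?thesis .
  qed
  moreover have "r \<ge> 0" if "r \<in> R" for r
    using that rpos by (auto simp: R_def intro: less_imp_le)
  ultimately show ?thesis using R cpos by blast
qed

section \<open>The Laplace transform on the positive half-line\<close>

lemma exp_integral_Ioi:
  fixes p c :: real
  assumes "p > 0"
  shows "set_integrable lborel {c<..} (\<lambda>t. exp (- p * t))"
    "(LINT t:{c<..}|lborel. exp (- p * t)) = exp (- p * c) / p"
proof -
  have "((\<lambda>x. exp (- p * x)) has_integral exp (- p * c) / p) {c..}"
    using assms by (rule has_integral_exp_minus_to_infinity)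
  then have I: "((\<lambda>x. exp (- p * x)) has_integral exp (- p * c) / p) {c<..}"
    by (subst has_integral_spike_set_eq[of _ "{c..}"])
      (auto intro: negligible_subset[of "{c}"])
  then have "(\<lambda>x. exp (- p * x)) absolutely_integrable_on {c<..}"
    by (intro nonnegative_absolutely_integrable_1) auto
  moreover have "set_borel_measurable borel {c<..} (\<lambda>t. exp (- p * t))"
    by (intro set_measurable_continuous_on continuous_intros) auto
  ultimately show S: "set_integrable lborel {c<..} (\<lambda>t. exp (- p * t))"
    unfolding set_integrable_def set_borel_measurable_def
    by (subst (asm) integrable_completion) auto
  show "(LINT t:{c<..}|lborel. exp (- p * t)) = exp (- p * c) / p"
    using set_borel_integral_eq_integral(2)[OF S] I by (simp add: integral_unique)
qed

lemma laplace_existsI: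
  assumes "continuous_on {0<..} g" and q: "q > 0"
    and "\<And>t. t > 0 \<Longrightarrow> \<bar>exp (- p * t) * g t\<bar> \<le> C * exp (- q * t)"
  shows "laplace_exists g p"
  unfolding laplace_exists_def
proof (rule set_integrable_bound)
  show "set_integrable lborel {0<..} (\<lambda>t. C * exp (- q * t))"
    using exp_integral_Ioi(1)[OF q] by (rule set_integrable_mult_right)
  have "set_borel_measurable borel {0<..} (\<lambda>t. exp (- p * t) * g t)"
    by (intro set_measurable_continuous_on continuous_intros assms) auto
  then show "set_borel_measurable lborel {0<..} (\<lambda>t. exp (- p * t) * g t)"
    unfolding set_borel_measurable_def by simp
  show "AE x in lborel. x \<in> {0<..} \<longrightarrow> norm (exp (- p * x) * g x) \<le> norm (C * exp (- q * x))"
    using assms(3) by (intro AE_I2) (fastforce intro: order_trans)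
qed

lemma laplace_mono:
  assumes "laplace_exists g p" "laplace_exists h p" "\<And>t. t > 0 \<Longrightarrow> g t \<le> h t"
  shows "laplace g p \<le> laplace h p"
  using assms unfolding laplace_def laplace_exists_def
  by (intro set_integral_mono) (auto intro: mult_left_mono)

lemma laplace_add_scale:
  assumes "laplace_exists g p" "laplace_exists h p"
  shows "laplace_exists (\<lambda>t. c * g t + h t) p"
    "laplace (\<lambda>t. c * g t + h t) p = c * laplace g p + laplace h p"
proof -
  have eq: "exp (- p * t) * (c * g t + h t) = c * (exp (- p * t) * g t) + exp (- p * t) * h t" for t
    by (simp add: algebra_simps)
  have cg: "set_integrable lborel {0<..} (\<lambda>t. c * (exp (- p * t) * g t))"
    using assms(1) unfolding laplace_exists_def by (rule set_integrable_mult_right)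
  show "laplace_exists (\<lambda>t. c * g t + h t) p"
    unfolding laplace_exists_def eq using cg assms(2)
    unfolding laplace_exists_def by (rule set_integral_add)
  show "laplace (\<lambda>t. c * g t + h t) p = c * laplace g p + laplace h p"
    unfolding laplace_def eq using cg assms(2) unfolding laplace_exists_def
    by (subst set_integral_add) auto
qed

lemma laplace_exp:
  assumes "p + \<mu> > 0"
  shows "laplace_exists (\<lambda>t. exp (- \<mu> * t)) p" "laplace (\<lambda>t. exp (- \<mu> * t)) p = 1 / (p + \<mu>)"
proof -
  have eq: "exp (- p * t) * exp (- \<mu> * t) = exp (- (p + \<mu>) * t)" for t
    by (simp add: algebra_simps flip: exp_add)
  show "laplace_exists (\<lambda>t. exp (- \<mu> * t)) p" "laplace (\<lambda>t. exp (- \<mu> * t)) p = 1 / (p + \<mu>)"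
    unfolding laplace_exists_def laplace_def eq using exp_integral_Ioi[OF assms, of 0] by auto
qed

lemma laplace_const:
  assumes "p > 0"
  shows "laplace_exists (\<lambda>_. c) p" "laplace (\<lambda>_. c) p = c / p"
  using assms laplace_exp[of p 0] laplace_add_scale[of "\<lambda>_. 1" p "\<lambda>_. 0" c]
  by (auto simp: laplace_def laplace_exists_def)

lemma laplace_tail:
  assumes "p > 0" "T \<ge> 0"
  shows "laplace_exists (indicator {T<..}) p" "laplace (indicator {T<..}) p = exp (- p * T) / p"
proof -
  have eq: "indicat_real {0<..} t *\<^sub>R (exp (- p * t) * indicator {T<..} t)
    = indicator {T<..} t *\<^sub>R exp (- p * t)" for t
    using assms by (auto simp: indicator_def)
  show "laplace_exists (indicator {T<..}) p" "laplace (indicator {T<..}) p = exp (- p * T) / p"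
    unfolding laplace_exists_def laplace_def set_integrable_def set_lebesgue_integral_def eq
    using exp_integral_Ioi[OF assms(1), of T]
    unfolding set_integrable_def set_lebesgue_integral_def by auto
qed

lemma laplace_dominated_convergence:
  assumes g: "\<And>m. laplace_exists (g m) p" and w: "laplace_exists w p"
    and lim: "\<And>t. t > 0 \<Longrightarrow> (\<lambda>m. g m t) \<longlonglongrightarrow> G t"
    and bound: "\<And>m t. t > 0 \<Longrightarrow> \<bar>g m t\<bar> \<le> w t"
  shows "laplace_exists G p" "(\<lambda>m. laplace (g m) p) \<longlonglongrightarrow> laplace G p"
proof -
  let ?f = "\<lambda>g t. indicat_real {0<..} t *\<^sub>R (exp (- p * t) * g t)"
  have lim': "(\<lambda>m. ?f (g m) t) \<longlonglongrightarrow> ?f G t" for t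
    by (cases "t > 0") (auto intro!: tendsto_intros lim)
  have meas: "?f (g m) \<in> borel_measurable lborel" for m
    using g[of m] unfolding laplace_exists_def set_integrable_def by auto
  have measG: "?f G \<in> borel_measurable lborel"
    by (rule borel_measurable_LIMSEQ_real[OF lim' meas])
  have bd: "norm (?f (g m) t) \<le> ?f w t" for m t
    using bound[of t m] by (auto simp: indicator_def abs_mult)
  have wi: "integrable lborel (?f w)"
    using w unfolding laplace_exists_def set_integrable_def .
  show "laplace_exists G p"
    unfolding laplace_exists_def set_integrable_def
    by (rule integrable_dominated_convergence[where s = "\<lambda>m. ?f (g m)", OF measG meas wi]) (use lim' bd in auto)
  show "(\<lambda>m. laplace (g m) p) \<longlonglongrightarrow> laplace G p"
    unfolding laplace_def set_lebesgue_integral_def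
    by (rule integral_dominated_convergence[OF measG meas wi]) (use lim' bd in auto)
qed

text \<open>
  Linear growth is absorbed by half of the exponential decay; this makes Laplace transforms of functions
  of linear growth converge and gives the bound of \<open>laplace_linear_le\<close>.
\<close>

lemma linear_times_exp_le:
  fixes t p d :: real
  assumes "t > 0" "p > 0" "d > 0"
  shows "exp (- p * t) * (1 + t / d) \<le> (1 + 2 / (p * d)) * exp (- (p / 2) * t)"
proof -
  have "1 + t / d \<le> (1 + 2 / (p * d)) * exp (p / 2 * t)"
  proof -
    have e: "1 + p / 2 * t \<le> exp (p / 2 * t)" by (rule exp_ge_add_one_self)
    have "1 + t / d \<le> (1 + 2 / (p * d)) * (1 + p / 2 * t)"
      using assms by (simp add: field_simps)
    also have "\<dots> \<le> (1 + 2 / (p * d)) * exp (p / 2 * t)"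
      using e assms by (intro mult_left_mono) auto
    finally show ?thesis .
  qed
  then have "exp (- p * t) * (1 + t / d) \<le> exp (- p * t) * ((1 + 2 / (p * d)) * exp (p / 2 * t))"
    by (intro mult_left_mono) auto
  also have "\<dots> = (1 + 2 / (p * d)) * exp (- (p / 2) * t)"
    by (simp add: mult.left_commute field_simps flip: exp_add)
  finally show ?thesis .
qed

lemma laplace_linear:
  assumes p: "p > 0" and d: "d > 0"
  shows "laplace_exists (\<lambda>t. 1 + t / d) p"
  by (rule laplace_existsI[where q = "p / 2" and C = "1 + 2 / (p * d)"])
    (use assms linear_times_exp_le[of _ p d] in \<open>auto intro!: continuous_intros simp: abs_mult\<close>)

lemma laplace_linear_le:
  assumes p: "p > 0" and d: "d > 0"
  shows "p * laplace (\<lambda>t. 1 + t / d) p \<le> 1 + 4 / (p * d)"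
proof -
  have "laplace (\<lambda>t. t / d) p \<le> laplace (\<lambda>t. 2 / (p * d) * exp (- (- (p / 2)) * t) + 0) p"
  proof (rule laplace_mono)
    show "laplace_exists (\<lambda>t. t / d) p"
      using laplace_add_scale(1)[OF laplace_const(1)[OF p, of 1] laplace_linear[OF assms], of "-1"]
      by simp
    show "laplace_exists (\<lambda>t. 2 / (p * d) * exp (- (- (p / 2)) * t) + 0) p"
      using p by (intro laplace_add_scale laplace_exp laplace_const) auto
    fix t :: real assume t: "t > 0"
    have "t / d \<le> 2 / (p * d) * (1 + p / 2 * t)" using p d by (simp add: field_simps)
    also have "\<dots> \<le> 2 / (p * d) * exp (p / 2 * t)"
      using p d exp_ge_add_one_self[of "p / 2 * t"] by (intro mult_left_mono) auto
    finally show "t / d \<le> 2 / (p * d) * exp (- (- (p / 2)) * t) + 0" by simp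
  qed
  also have "\<dots> = 2 / (p * d) * (2 / p)"
  proof -
    have "p + - (p / 2) > 0" using p by simp
    note e = laplace_exp[OF this]
    show ?thesis
      unfolding laplace_add_scale(2)[OF e(1) laplace_const(1)[OF p]] e(2) laplace_const(2)[OF p]
      using p by (simp add: field_simps)
  qed
  finally have *: "laplace (\<lambda>t. t / d) p \<le> 4 / (p * d * p)" by simp
  have "laplace (\<lambda>t. 1 + t / d) p = 1 / p + laplace (\<lambda>t. t / d) p"
    using laplace_add_scale(2)[of "\<lambda>_. 1" p "\<lambda>t. t / d" 1] laplace_const[OF p, of 1]
      laplace_add_scale(1)[OF laplace_const(1)[OF p, of 1] laplace_linear[OF assms], of "-1"]
    by simp
  also have "p * \<dots> \<le> p * (1 / p + 4 / (p * d * p))"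
    using p * by (intro mult_left_mono) auto
  also have "\<dots> = 1 + 4 / (p * d)" using p d by (simp add: field_simps)
  finally show ?thesis by simp
qed

lemma bernstein_continuous_on: "bernstein h \<Longrightarrow> continuous_on {0<..} h"
  unfolding bernstein_def by (auto elim: continuous_on_subset)

lemma bernstein_laplace_exists:
  assumes h: "bernstein h" and p: "p > 0"
  shows "laplace_exists h p"
proof (rule laplace_existsI[where q = "p / 2" and C = "h 1 * (1 + 2 / p)"])
  fix t :: real assume t: "t > 0"
  have "\<bar>exp (- p * t) * h t\<bar> = exp (- p * t) * h t"
    using bernstein_nonneg[OF h, of t] t by (simp add: abs_mult)
  also have "\<dots> \<le> exp (- p * t) * (h 1 * (1 + t / 1))"
    using t by (intro mult_left_mono bernstein_linear_bound[OF h]) auto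
  also have "\<dots> = h 1 * (exp (- p * t) * (1 + t / 1))" by simp
  also have "\<dots> \<le> h 1 * ((1 + 2 / (p * 1)) * exp (- (p / 2) * t))"
    using t p by (intro mult_left_mono linear_times_exp_le bernstein_nonneg[OF h]) auto
  finally show "\<bar>exp (- p * t) * h t\<bar> \<le> h 1 * (1 + 2 / p) * exp (- (p / 2) * t)" by simp
qed (use p bernstein_continuous_on[OF h] in auto)

text \<open>
  Monotonicity: \<open>h\<close> stays above \<open>h T\<close> after time \<open>T\<close>.
\<close>

lemma bernstein_le_laplace:
  assumes h: "bernstein h" and p: "p > 0" and T: "T \<ge> 0"
  shows "h T * exp (- p * T) \<le> p * laplace h p"
proof -
  have ex: "laplace_exists (\<lambda>t. h T * indicator {T<..} t + 0) p"
    by (intro laplace_add_scale laplace_tail laplace_const p T)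
  have "h T * (exp (- p * T) / p) = laplace (\<lambda>t. h T * indicator {T<..} t + 0) p"
    by (subst laplace_add_scale) (use p T in \<open>auto simp: laplace_tail laplace_const\<close>)
  also have "\<dots> \<le> laplace h p"
  proof (rule laplace_mono[OF ex bernstein_laplace_exists[OF h p]])
    fix t :: real assume "t > 0"
    then show "h T * indicator {T<..} t + 0 \<le> h t"
      using bernstein_mono[OF h, of T t] bernstein_nonneg[OF h, of t] T
      by (auto simp: indicator_def)
  qed
  finally show ?thesis using p by (simp add: field_simps)
qed

section \<open>Transforms of Bernstein functions and their pointwise limits\<close>

text \<open>
  The sign conditions live on the open half-line; the missing value at 0 is the infimum, which is the
  right limit because the function is increasing.
\<close>

lemma bernstein_extension:
  fixes D :: "nat \<Rightarrow> real \<Rightarrow> real"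
  assumes D: "\<And>n t. t > 0 \<Longrightarrow> (D n has_real_derivative D (Suc n) t) (at t)"
    and nonneg: "\<And>t. t > 0 \<Longrightarrow> D 0 t \<ge> 0"
    and sgn: "\<And>n t. n \<ge> 1 \<Longrightarrow> t > 0 \<Longrightarrow> (-1) ^ n * D n t \<le> 0"
  shows "\<exists>h. bernstein h \<and> (\<forall>t>0. h t = D 0 t)"
proof -
  define h where "h t = (if t > 0 then D 0 t else Inf (D 0 ` {0<..}))" for t
  have mono: "D 0 s \<le> D 0 t" if "0 < s" "s \<le> t" for s t
  proof (rule DERIV_nonneg_imp_nondecreasing[OF that(2)])
    fix x assume "s \<le> x" "x \<le> t"
    then have "x > 0" using that by simp
    then show "\<exists>y. (D 0 has_real_derivative y) (at x) \<and> 0 \<le> y"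
      using D[of x 0] sgn[of 1 x] by (intro exI[of _ "D 1 x"]) auto
  qed
  have "(D 0 \<longlongrightarrow> Inf (D 0 ` ({0<..} \<inter> UNIV))) (at 0 within ({0<..} \<inter> UNIV))"
    by (rule Lim_right_bound[where K = 0]) (use mono nonneg in auto)
  then have "(D 0 \<longlongrightarrow> h 0) (at_right 0)" by (simp add: h_def)
  then have "(h \<longlongrightarrow> h 0) (at_right 0)"
    by (rule Lim_transform_eventually)
      (auto simp: h_def eventually_at_right_field intro: exI[of _ 1])
  then have "continuous (at 0 within {0..}) h"
    by (simp add: continuous_within at_within_Ici_at_right)
  moreover have "continuous (at x within {0..}) h" if "x > 0" for x
  proof -
    have "(h has_real_derivative D (Suc 0) x) (at x)"
      by (rule has_field_derivative_transform_within_open[OF D[of x 0], where S = "{0<..}"])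
        (use that in \<open>auto simp: h_def\<close>)
    then show ?thesis using DERIV_isCont continuous_at_imp_continuous_at_within by blast
  qed
  ultimately have "continuous_on {0..} h"
    unfolding continuous_on_eq_continuous_within by (metis atLeast_iff le_less)
  then have "bernstein h"
    by (intro bernsteinI[where D = D and h = h]) (use D nonneg sgn in \<open>auto simp: h_def\<close>)
  then show ?thesis by (auto simp: h_def)
qed

text \<open>
  The factor \<open>p\<close> makes the class contain the constants and all \<open>1 / (p + r)\<close>, the building blocks of
  partial fractions.
\<close>

definition bernstein_transform :: "(real \<Rightarrow> real) \<Rightarrow> bool" where
  "bernstein_transform \<Phi> \<longleftrightarrow> (\<exists>h. bernstein h \<and> (\<forall>p>0. p * laplace h p = \<Phi> p))"

lemma bernstein_transform_cong:
  "(\<And>p. p > 0 \<Longrightarrow> \<Phi> p = \<Psi> p) \<Longrightarrow> bernstein_transform \<Phi> = bernstein_transform \<Psi>"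
  unfolding bernstein_transform_def by auto

lemma bernstein_transform_zero: "bernstein_transform (\<lambda>_. 0)"
  unfolding bernstein_transform_def
proof (intro exI conjI)
  show "bernstein (\<lambda>_. 0)"
    by (rule bernsteinI[where D = "\<lambda>_ _. 0"]) auto
qed (simp add: laplace_def)

lemma bernstein_transform_add_scale:
  assumes "bernstein_transform \<Phi>" "bernstein_transform \<Psi>" and c: "c \<ge> 0"
  shows "bernstein_transform (\<lambda>p. c * \<Phi> p + \<Psi> p)"
proof -
  obtain g h where g: "bernstein g" "\<And>p. p > 0 \<Longrightarrow> p * laplace g p = \<Phi> p"
    and h: "bernstein h" "\<And>p. p > 0 \<Longrightarrow> p * laplace h p = \<Psi> p"
    using assms unfolding bernstein_transform_def by auto
  have "bernstein (\<lambda>t. c * g t + h t)"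
  proof (rule bernsteinI[where D = "\<lambda>n t. c * (deriv ^^ n) g t + (deriv ^^ n) h t"])
    fix n and t :: real assume t: "t > 0"
    show "((\<lambda>t. c * (deriv ^^ n) g t + (deriv ^^ n) h t) has_real_derivative
        c * (deriv ^^ Suc n) g t + (deriv ^^ Suc n) h t) (at t)"
      by (intro DERIV_add DERIV_cmult bernstein_has_derivative g h t)
    show "(-1) ^ n * (c * (deriv ^^ n) g t + (deriv ^^ n) h t) \<le> 0" if n: "n \<ge> 1"
    proof -
      have "(-1) ^ n * (deriv ^^ n) g t \<le> 0" "(-1) ^ n * (deriv ^^ n) h t \<le> 0"
        using g(1) h(1) n t unfolding bernstein_def by blast+
      then have "c * ((-1) ^ n * (deriv ^^ n) g t) + (-1) ^ n * (deriv ^^ n) h t \<le> 0"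
        using c by (simp add: add_nonpos_nonpos mult_nonneg_nonpos)
      then show ?thesis by (simp add: algebra_simps)
    qed
  next
    fix t :: real assume t: "t > 0"
    show "c * (deriv ^^ 0) g t + (deriv ^^ 0) h t \<ge> 0"
      using bernstein_nonneg[OF g(1), of t] bernstein_nonneg[OF h(1), of t] c t by simp
  next
    show "continuous_on {0..} (\<lambda>t. c * g t + h t)"
      using g(1) h(1) unfolding bernstein_def by (intro continuous_intros) auto
  qed auto
  moreover have "p * laplace (\<lambda>t. c * g t + h t) p = c * \<Phi> p + \<Psi> p" if p: "p > 0" for p
    using laplace_add_scale(2)[OF bernstein_laplace_exists[OF g(1) p] bernstein_laplace_exists[OF h(1) p], of c]
      g(2)[OF p] h(2)[OF p]
    by (simp add: distrib_left mult.left_commute)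
  ultimately show ?thesis unfolding bernstein_transform_def by blast
qed

lemma bernstein_transform_sum:
  assumes "finite R" "\<And>r. r \<in> R \<Longrightarrow> c r \<ge> 0" "\<And>r. r \<in> R \<Longrightarrow> bernstein_transform (\<Phi> r)"
  shows "bernstein_transform (\<lambda>p. \<Sum>r\<in>R. c r * \<Phi> r p)"
  using assms
proof (induction R rule: finite_induct)
  case empty
  then show ?case by (simp add: bernstein_transform_zero)
next
  case (insert r R)
  then show ?case by (simp add: bernstein_transform_add_scale)
qed

text \<open>
  A bound on \<open>p * laplace (h m) p\<close> at \<open>p = 1\<close> bounds \<open>h m 1\<close>, and this bounds \<open>h m\<close> by a common linear
  function.  A diagonal subsequence converges at all positive rationals; the ratio estimate
  makes the family equicontinuous and extends the convergence to all \<open>t > 0\<close>, and the derivative bounds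
  extend it to all derivatives.  The linear bound also dominates the Laplace integrals.
\<close>

lemma bernstein_transform_limit:
  assumes \<Phi>: "\<And>m::nat. bernstein_transform (\<Phi> m)"
    and lim: "\<And>p. p > 0 \<Longrightarrow> (\<lambda>m. \<Phi> m p) \<longlonglongrightarrow> \<Psi> p"
  shows "bernstein_transform \<Psi>"
proof -
  obtain h where h: "\<And>m. bernstein (h m)" and L: "\<And>m p. p > 0 \<Longrightarrow> p * laplace (h m) p = \<Phi> m p"
    using \<Phi> unfolding bernstein_transform_def by metis
  have "Bseq (\<lambda>m. \<Phi> m 1)" using lim[of 1] by (intro convergent_imp_Bseq convergentI) auto
  then obtain K where K: "K > 0" "\<And>m. \<bar>\<Phi> m 1\<bar> \<le> K" unfolding Bseq_def by auto
  define C where "C = exp 1 * K"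
  have C0: "C > 0" using K by (simp add: C_def)
  have h1: "h m 1 \<le> C" for m
  proof -
    have "h m 1 * exp (- 1 * 1) \<le> 1 * laplace (h m) 1"
      by (rule bernstein_le_laplace[OF h]) auto
    also have "\<dots> \<le> K" using L[of 1 m] K(2)[of m] by simp
    finally show ?thesis by (simp add: C_def exp_minus field_simps)
  qed
  have hC: "h m t \<le> C * (1 + t)" if "t > 0" for m t
  proof -
    have "h m t \<le> h m 1 * (1 + t)"
      using bernstein_linear_bound[OF h, of t 1 m] that by simp
    also have "\<dots> \<le> C * (1 + t)" using h1 that by (intro mult_right_mono) auto
    finally show ?thesis .
  qed
  have h0: "h m t \<ge> 0" if "t \<ge> 0" for m t using bernstein_nonneg[OF h that] .
  \<comment> \<open>Dividing by \<open>1 + x\<close> turns the linear bound into a uniform one.\<close>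
  obtain k where k: "strict_mono (k :: nat \<Rightarrow> nat)"
    and k': "\<And>x. x \<in> \<rat> \<inter> {0<..} \<Longrightarrow> \<exists>l. (\<lambda>m. h (k m) x / (1 + x)) \<longlonglongrightarrow> l"
  proof (rule function_convergent_subsequence[of "\<rat> \<inter> {0<..}" "\<lambda>m x. h m x / (1 + x)" C])
    show "countable (\<rat> \<inter> {0<..} :: real set)" using countable_rat by (rule countable_subset[rotated]) auto
    fix n and x :: real assume "x \<in> \<rat> \<inter> {0<..}"
    then show "norm (h n x / (1 + x)) \<le> C"
      using hC[of x n] h0[of x n] by (simp add: field_simps)
  qed blast
  have convQ: "convergent (\<lambda>m. h (k m) x)" if x: "x \<in> \<rat> \<inter> {0<..}" for x
  proof -
    obtain l where "(\<lambda>m. h (k m) x / (1 + x)) \<longlonglongrightarrow> l" using k'[OF x] by auto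
    then have "(\<lambda>m. h (k m) x / (1 + x) * (1 + x)) \<longlonglongrightarrow> l * (1 + x)" by (intro tendsto_intros)
    moreover have "h (k m) x / (1 + x) * (1 + x) = h (k m) x" for m using x by simp
    ultimately show ?thesis by (auto intro: convergentI)
  qed
  have conv: "convergent (\<lambda>m. h (k m) t)" if t: "t > 0" for t
  proof -
    have "Cauchy (\<lambda>m. h (k m) t)"
    proof (rule metric_CauchyI)
      fix e :: real assume e: "e > 0"
      define M where "M = C * (1 + t)"
      have M: "M > 0" using C0 t by (simp add: M_def)
      \<comment> \<open>Chosen so that \<open>s > l\<close> gives \<open>(t / s - 1) * M < e / 3\<close>.\<close>
      define l where "l = t / (1 + e / (3 * M))"
      have l: "0 < l" "l < t" using t e M by (auto simp: l_def field_simps)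
      obtain s where s: "s \<in> \<rat>" "l < s" "s < t" using Rats_dense_in_real[OF l(2)] by auto
      have st: "(t / s - 1) * M < e / 3"
      proof -
        have "t / s < t / l" using s l t by (simp add: frac_less2)
        also have "t / l = 1 + e / (3 * M)" using t e M by (simp add: l_def)
        finally have "(t / s - 1) * M < e / (3 * M) * M" using M by (intro mult_strict_right_mono) auto
        then show ?thesis using M by simp
      qed
      have close: "\<bar>h m t - h m s\<bar> < e / 3" for m
      proof -
        have a: "h m s \<le> h m t" using s l by (intro bernstein_mono[OF h]) auto
        have "h m t - h m s \<le> (t / s - 1) * h m s"
          using bernstein_ratio[OF h, of s t m] s l by (simp add: algebra_simps)
        also have "\<dots> \<le> (t / s - 1) * M"
        proof (rule mult_left_mono)
          have "h m s \<le> C * (1 + s)" using s l by (intro hC) auto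
          also have "\<dots> \<le> M" using s C0 by (simp add: M_def)
          finally show "h m s \<le> M" .
        qed (use s l in auto)
        finally show ?thesis using a st by linarith
      qed
      have "Cauchy (\<lambda>m. h (k m) s)" using convQ[of s] s l by (intro convergent_Cauchy) auto
      from metric_CauchyD[OF this, of "e / 3"] e
      obtain N where N: "\<And>m n. m \<ge> N \<Longrightarrow> n \<ge> N \<Longrightarrow> \<bar>h (k m) s - h (k n) s\<bar> < e / 3"
        unfolding dist_real_def by auto
      show "\<exists>N. \<forall>m\<ge>N. \<forall>n\<ge>N. dist (h (k m) t) (h (k n) t) < e"
      proof (intro exI[of _ N] allI impI)
        fix m n assume "m \<ge> N" "n \<ge> N"
        then show "dist (h (k m) t) (h (k n) t) < e"
          using N[of m n] close[of "k m"] close[of "k n"] unfolding dist_real_def by linarith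
      qed
    qed
    then show ?thesis by (simp add: Cauchy_convergent_iff)
  qed
  define D where "D n t = lim (\<lambda>m. (deriv ^^ n) (h (k m)) t)" for n t
  have step: "convergent (\<lambda>m. (deriv ^^ Suc n) (h (k m)) t) \<and>
      (D n has_real_derivative D (Suc n) t) (at t)"
    if c: "\<And>t. t > 0 \<Longrightarrow> convergent (\<lambda>m. (deriv ^^ n) (h (k m)) t)" and t: "t > 0" for n t
    unfolding D_def[of "Suc n"]
  proof (rule derivative_of_pointwise_limit[where f'' = "\<lambda>m. (deriv ^^ Suc (Suc n)) (h (k m))"])
    fix a :: real assume a: "a > 0"
    let ?N = "Suc (Suc n)"
    show "\<exists>B. \<forall>m. \<forall>t\<ge>a. \<bar>(deriv ^^ ?N) (h (k m)) t\<bar> \<le> B"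
    proof (intro exI allI impI)
      fix m t assume t: "t \<ge> a"
      have "\<bar>(deriv ^^ ?N) (h (k m)) t\<bar> \<le> \<bar>(deriv ^^ ?N) (h (k m)) a\<bar>"
        using a t by (intro bernstein_deriv_antimono[OF h]) auto
      also have "\<dots> \<le> (2 ^ ?N / a) ^ ?N * h (k m) a"
        using a by (rule bernstein_deriv_bound[OF h])
      also have "\<dots> \<le> (2 ^ ?N / a) ^ ?N * (C * (1 + a))"
        using a by (intro mult_left_mono hC) auto
      finally show "\<bar>(deriv ^^ ?N) (h (k m)) t\<bar> \<le> (2 ^ ?N / a) ^ ?N * (C * (1 + a))" .
    qed
  next
    show "(\<lambda>m. (deriv ^^ n) (h (k m)) t) \<longlonglongrightarrow> D n t" if "t > 0" for t
      unfolding D_def using c[OF that] by (simp add: convergent_LIMSEQ_iff)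
  qed (assumption | rule t bernstein_has_derivative[OF h])+
  have conv_n: "convergent (\<lambda>m. (deriv ^^ n) (h (k m)) t)" if "t > 0" for n t
    using that
  proof (induction n arbitrary: t)
    case 0
    then show ?case using conv by simp
  next
    case (Suc n)
    then show ?case using step by blast
  qed
  have Dlim: "(\<lambda>m. (deriv ^^ n) (h (k m)) t) \<longlonglongrightarrow> D n t" if "t > 0" for n t
    unfolding D_def using conv_n[OF that] by (simp add: convergent_LIMSEQ_iff)
  have "\<exists>H. bernstein H \<and> (\<forall>t>0. H t = D 0 t)"
  proof (rule bernstein_extension)
    fix n and t :: real assume t: "t > 0"
    show "(D n has_real_derivative D (Suc n) t) (at t)" using step conv_n t by blast
    show "(-1) ^ n * D n t \<le> 0" if n: "n \<ge> 1"
    proof (rule LIMSEQ_le_const2)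
      show "(\<lambda>m. (-1) ^ n * (deriv ^^ n) (h (k m)) t) \<longlonglongrightarrow> (-1) ^ n * D n t"
        by (intro tendsto_intros Dlim t)
      show "\<exists>N. \<forall>m\<ge>N. (-1) ^ n * (deriv ^^ n) (h (k m)) t \<le> 0"
        using h n t unfolding bernstein_def by blast
    qed
  next
    fix t :: real assume t: "t > 0"
    show "D 0 t \<ge> 0"
      by (rule LIMSEQ_le_const[OF Dlim[OF t]]) (use h0 t in auto)
  qed
  then obtain H where H: "bernstein H" "\<And>t. t > 0 \<Longrightarrow> H t = D 0 t" by auto
  have "p * laplace H p = \<Psi> p" if p: "p > 0" for p
  proof -
    have "(\<lambda>m. laplace (h (k m)) p) \<longlonglongrightarrow> laplace H p"
    proof (rule laplace_dominated_convergence(2)[where w = "\<lambda>t. C * (1 + t / 1) + 0"])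
      show "laplace_exists (\<lambda>t. C * (1 + t / 1) + 0) p"
        using p by (intro laplace_add_scale laplace_linear laplace_const) auto
      show "(\<lambda>m. h (k m) t) \<longlonglongrightarrow> H t" if "t > 0" for t
        using Dlim[OF that, of 0] H(2)[OF that] by simp
      show "\<bar>h (k m) t\<bar> \<le> C * (1 + t / 1) + 0" if "t > 0" for m t
        using hC[OF that, of "k m"] h0[of t "k m"] that by simp
    qed (use bernstein_laplace_exists[OF h p] in auto)
    then have "(\<lambda>m. p * laplace (h (k m)) p) \<longlonglongrightarrow> p * laplace H p" by (intro tendsto_intros)
    moreover have "(\<lambda>m. \<Phi> (k m) p) \<longlonglongrightarrow> \<Psi> p"
      using LIMSEQ_subseq_LIMSEQ[OF lim[OF p] k] by (simp add: o_def)
    ultimately show ?thesis using L[OF p] LIMSEQ_unique by simp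
  qed
  then show ?thesis using H(1) unfolding bernstein_transform_def by blast
qed

text \<open>
  For \<open>r > 0\<close> the function is \<open>(1 - exp (- r t)) / r\<close>; the case \<open>r = 0\<close>, where it degenerates to \<open>t\<close>, is
  obtained as a limit.
\<close>

lemma bernstein_transform_simple_fraction:
  assumes "r \<ge> 0"
  shows "bernstein_transform (\<lambda>p. 1 / (p + r))"
proof -
  have pos: "bernstein_transform (\<lambda>p. 1 / (p + r))" if r: "r > 0" for r
    unfolding bernstein_transform_def
  proof (intro exI conjI allI impI)
    let ?h = "\<lambda>t. (- 1 / r) * exp (- r * t) + 1 / r"
    let ?D = "\<lambda>n t. case n of 0 \<Rightarrow> ?h t | Suc m \<Rightarrow> (- r) ^ m * exp (- r * t)"
    show "bernstein ?h"
    proof (rule bernsteinI[where D = ?D])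
      fix n and t :: real
      show "(?D n has_real_derivative ?D (Suc n) t) (at t)"
        by (cases n) (use r in \<open>auto intro!: derivative_eq_intros simp: field_simps\<close>)
      show "(-1) ^ n * ?D n t \<le> 0" if n: "n \<ge> 1"
      proof -
        obtain m where m: "n = Suc m" using n by (cases n) auto
        have "(-1) ^ n * ?D n t = - (((- 1) * (- r)) ^ m * exp (- r * t))"
          unfolding power_mult_distrib by (simp add: m)
        also have "\<dots> \<le> 0" using r by simp
        finally show ?thesis .
      qed
      show "?D 0 t \<ge> 0" if "t > 0" using r that by (simp add: field_simps)
    qed (use r in \<open>auto intro!: continuous_intros\<close>)
    fix p :: real assume p: "p > 0"
    have L: "laplace ?h p = (- 1 / r) * (1 / (p + r)) + 1 / r / p"
      using p r by (subst laplace_add_scale(2)) (simp_all only: laplace_exp laplace_const add_pos_pos)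
    show "p * laplace ?h p = 1 / (p + r)"
    proof -
      have ne: "p \<noteq> 0" "r \<noteq> 0" "p + r \<noteq> 0" using p r by auto
      have "(- 1 / r) * (1 / (p + r)) + 1 / r / p = (- p + (p + r)) / (r * (p + r) * p)"
        using ne by (simp add: add_frac_eq) (simp add: divide_simps)
      also have "p * \<dots> = 1 / (p + r)" using ne by simp
      finally show ?thesis by (simp only: L)
    qed
  qed
  show ?thesis
  proof (cases "r = 0")
    case True
    have "bernstein_transform (\<lambda>p. 1 / p)"
    proof (rule bernstein_transform_limit[where \<Phi> = "\<lambda>m p. 1 / (p + inverse (real (Suc m)))"])
      show "(\<lambda>m. 1 / (p + inverse (real (Suc m)))) \<longlonglongrightarrow> 1 / p" if "p > 0" for p :: real
        using tendsto_divide[OF tendsto_const tendsto_add[OF tendsto_const LIMSEQ_inverse_real_of_nat], of p 1]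
          that by simp
    qed (rule pos, simp)
    then show ?thesis using True by simp
  next
    case False
    then show ?thesis using assms pos by simp
  qed
qed

section \<open>Completely monotone functions as limits of exponential sums\<close>

definition completely_monotone :: "(real \<Rightarrow> real) \<Rightarrow> bool" where
  "completely_monotone g \<longleftrightarrow> smooth_pos g \<and> (\<forall>n. \<forall>t>0. (-1) ^ n * (deriv ^^ n) g t \<ge> 0)"

lemma completely_monotone_nonneg:
  assumes "completely_monotone g" "t > 0"
  shows "g t \<ge> 0"
proof -
  have "(-1) ^ 0 * (deriv ^^ 0) g t \<ge> 0"
    using assms unfolding completely_monotone_def by blast
  then show ?thesis by simp
qed

lemma completely_monotone_deriv_antimono:
  assumes g: "completely_monotone g" and st: "0 < s" "s \<le> t"
  shows "(-1) ^ n * (deriv ^^ n) g t \<le> (-1) ^ n * (deriv ^^ n) g s"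
proof (rule DERIV_nonpos_imp_nonincreasing[OF st(2)])
  fix x assume "s \<le> x" "x \<le> t"
  then have x: "x > 0" using st by simp
  have "(-1) ^ Suc n * (deriv ^^ Suc n) g x \<ge> 0"
    using g x unfolding completely_monotone_def by blast
  then have "(-1) ^ n * (deriv ^^ Suc n) g x \<le> 0" by simp
  moreover have "((\<lambda>x. (-1) ^ n * (deriv ^^ n) g x) has_real_derivative (-1) ^ n * (deriv ^^ Suc n) g x) (at x)"
    using g x unfolding completely_monotone_def by (intro DERIV_cmult smooth_pos_has_derivative) auto
  ultimately show "\<exists>y. ((\<lambda>x. (-1) ^ n * (deriv ^^ n) g x) has_real_derivative y) (at x) \<and> y \<le> 0"
    by blast
qed

lemma completely_monotone_antimono:
  "completely_monotone g \<Longrightarrow> 0 < s \<Longrightarrow> s \<le> t \<Longrightarrow> g t \<le> g s"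
  using completely_monotone_deriv_antimono[of g s t 0] by simp

lemma completely_monotone_isCont: "completely_monotone g \<Longrightarrow> t > 0 \<Longrightarrow> isCont g t"
  using smooth_pos_has_derivative[of g t 0] unfolding completely_monotone_def
  by (auto intro: DERIV_isCont)

text \<open>
  Each signed derivative is decreasing, so differences keep the signs.  Iterating this shows that equidistant samples
  have non-negative differences of every order.
\<close>

lemma completely_monotone_diff:
  assumes g: "completely_monotone g" and d: "\<delta> > 0"
  shows "completely_monotone (\<lambda>t. g t - g (t + \<delta>))"
proof -
  let ?D = "\<lambda>n t. (deriv ^^ n) g t - (deriv ^^ n) g (t + \<delta>)"
  have sp: "smooth_pos g" using g unfolding completely_monotone_def by simp
  have D: "(?D n has_real_derivative ?D (Suc n) t) (at t)" if t: "t > 0" for n t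
  proof (rule DERIV_diff)
    show "((deriv ^^ n) g has_real_derivative (deriv ^^ Suc n) g t) (at t)"
      using sp t by (rule smooth_pos_has_derivative)
    show "((\<lambda>t. (deriv ^^ n) g (t + \<delta>)) has_real_derivative (deriv ^^ Suc n) g (t + \<delta>)) (at t)"
      unfolding DERIV_shift[symmetric] using sp t d by (intro smooth_pos_has_derivative) auto
  qed
  have it: "(deriv ^^ n) (\<lambda>t. g t - g (t + \<delta>)) t = ?D n t" if t: "t > 0" for n t
    by (rule iterated_deriv_eq[where D = ?D, OF D _ t]) auto
  have "smooth_pos (\<lambda>t. g t - g (t + \<delta>))"
    by (rule smooth_posI[where D = ?D, OF D]) auto
  moreover have "(-1) ^ n * (deriv ^^ n) (\<lambda>t. g t - g (t + \<delta>)) t \<ge> 0" if t: "t > 0" for n t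
    using completely_monotone_deriv_antimono[OF g t, of "t + \<delta>" n] d it[OF t]
    by (simp add: right_diff_distrib)
  ultimately show ?thesis unfolding completely_monotone_def by blast
qed

text \<open>
  The signed difference \<open>(-1)\<^sup>j \<Delta>\<^sup>j a\<close> at \<open>k\<close>.  If \<open>a\<close> is the moment sequence of a measure on
  \<open>[0, 1]\<close>, it is the integral of \<open>x\<^sup>k (1 - x)\<^sup>j\<close>.
\<close>

primrec difference :: "(nat \<Rightarrow> real) \<Rightarrow> nat \<Rightarrow> nat \<Rightarrow> real" where
  "difference a 0 k = a k"
| "difference a (Suc j) k = difference a j k - difference a j (Suc k)"

lemma difference_completely_monotone:
  assumes g: "completely_monotone g" and "x > 0" and d: "\<delta> > 0"
  shows "difference (\<lambda>k. g (x + real k * \<delta>)) j k \<ge> 0"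
proof -
  have "\<exists>G. completely_monotone G \<and> (\<forall>k. difference (\<lambda>k. g (x + real k * \<delta>)) j k = G (x + real k * \<delta>))"
  proof (induction j)
    case 0
    then show ?case using g by auto
  next
    case (Suc j)
    then obtain G where G: "completely_monotone G"
      "\<And>k. difference (\<lambda>k. g (x + real k * \<delta>)) j k = G (x + real k * \<delta>)" by auto
    show ?case
    proof (intro exI conjI allI)
      show "completely_monotone (\<lambda>t. G t - G (t + \<delta>))"
        by (rule completely_monotone_diff[OF G(1) d])
      show "difference (\<lambda>k. g (x + real k * \<delta>)) (Suc j) k
          = G (x + real k * \<delta>) - G (x + real k * \<delta> + \<delta>)" for k
        by (simp only: difference.simps G(2)) (simp add: algebra_simps)
    qed
  qed
  then obtain G where G: "completely_monotone G"
    "difference (\<lambda>k. g (x + real k * \<delta>)) j k = G (x + real k * \<delta>)" by blast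
  have "x + real k * \<delta> > 0" using \<open>x > 0\<close> d by (simp add: add_pos_nonneg)
  then show ?thesis unfolding G(2) by (rule completely_monotone_nonneg[OF G(1)])
qed

lemma sum_binomial_Suc:
  fixes f :: "nat \<Rightarrow> real"
  shows "(\<Sum>i\<le>Suc M. real (Suc M choose i) * f i)
    = (\<Sum>i\<le>M. real (M choose i) * (f i + f (Suc i)))"
proof -
  have "(\<Sum>i\<le>M. real (M choose i) * f i) = (\<Sum>i\<le>Suc M. real (M choose i) * f i)"
    by (simp add: binomial_eq_0)
  also have "\<dots> = f 0 + (\<Sum>i\<le>M. real (M choose Suc i) * f (Suc i))"
    by (simp only: sum.atMost_Suc_shift) simp
  finally have *: "(\<Sum>i\<le>M. real (M choose i) * f i)
    = f 0 + (\<Sum>i\<le>M. real (M choose Suc i) * f (Suc i))" .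
  have "(\<Sum>i\<le>Suc M. real (Suc M choose i) * f i)
      = f 0 + (\<Sum>i\<le>M. real (M choose i) * f (Suc i)) + (\<Sum>i\<le>M. real (M choose Suc i) * f (Suc i))"
    by (simp only: sum.atMost_Suc_shift) (simp add: sum.distrib algebra_simps)
  then show ?thesis using * by (simp add: sum.distrib distrib_left)
qed

text \<open>
  If \<open>a\<close> is the moment sequence of a measure, this is the integral of
  \<open>x\<^sup>n (1 - x)\<^sup>j (x + (1 - x))\<^sup>M = x\<^sup>n (1 - x)\<^sup>j\<close>; the identity itself needs only Pascal's rule.
\<close>

lemma difference_binomial_sum:
  "(\<Sum>i\<le>M. real (M choose i) * difference a (j + M - i) (n + i)) = difference a j n"
proof (induction M arbitrary: j)
  case 0
  then show ?case by simp
next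
  case (Suc M)
  have "(\<Sum>i\<le>Suc M. real (Suc M choose i) * difference a (j + Suc M - i) (n + i))
    = (\<Sum>i\<le>M. real (M choose i) * (difference a (j + Suc M - i) (n + i)
         + difference a (j + Suc M - Suc i) (n + Suc i)))"
    by (rule sum_binomial_Suc)
  also have "\<dots> = (\<Sum>i\<le>M. real (M choose i) * difference a (j + M - i) (n + i))"
  proof (rule sum.cong)
    fix i assume "i \<in> {..M}"
    then have "j + Suc M - i = Suc (j + M - i)" by auto
    then show "real (M choose i) * (difference a (j + Suc M - i) (n + i)
         + difference a (j + Suc M - Suc i) (n + Suc i)) = real (M choose i) * difference a (j + M - i) (n + i)"
      by simp
  qed simp
  also have "\<dots> = difference a j n" by (rule Suc.IH)
  finally show ?case .
qed

text \<open>
  If \<open>a\<close> is the moment sequence of a measure, the weights \<open>(N choose k) * difference a (N - k) k\<close> are the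
  integrals of the binomial probabilities.  Factorial moments of a binomial distribution are multiples of
  powers of its parameter, so they recover \<open>a\<close> exactly, whereas ordinary moments only approximate it.
\<close>

lemma factorial_moment:
  assumes "n \<le> N"
  shows "(\<Sum>k\<le>N. real (N choose k) * difference a (N - k) k * real (k choose n)) = real (N choose n) * a n"
proof -
  have "(\<Sum>k\<le>N. real (N choose k) * difference a (N - k) k * real (k choose n))
    = (\<Sum>k\<in>{n..N}. real (N choose k) * difference a (N - k) k * real (k choose n))"
    by (rule sum.mono_neutral_right) (auto simp: binomial_eq_0)
  also have "\<dots> = (\<Sum>i\<in>{..N-n}. real (N choose (n + i)) * difference a (N - (n + i)) (n + i) * real ((n + i) choose n))"
    by (rule sum.reindex_bij_witness[where i = "\<lambda>i. n + i" and j = "\<lambda>k. k - n"]) (use assms in auto)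
  also have "\<dots> = (\<Sum>i\<in>{..N-n}. real (N choose n) * (real ((N - n) choose i) * difference a (0 + (N - n) - i) (n + i)))"
  proof (rule sum.cong)
    fix i assume i: "i \<in> {..N-n}"
    have "(N choose (n + i)) * ((n + i) choose n) = (N choose n) * ((N - n) choose i)"
      using choose_mult[of n "n + i" N] i assms by simp
    then have "real (N choose (n + i)) * real ((n + i) choose n) = real (N choose n) * real ((N - n) choose i)"
      by (simp flip: of_nat_mult)
    moreover have "N - (n + i) = 0 + (N - n) - i" by simp
    ultimately show "real (N choose (n + i)) * difference a (N - (n + i)) (n + i) * real ((n + i) choose n)
      = real (N choose n) * (real ((N - n) choose i) * difference a (0 + (N - n) - i) (n + i))"
      by (simp add: algebra_simps)
  qed simp
  also have "\<dots> = real (N choose n) * difference a 0 n"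
    unfolding sum_distrib_left[symmetric] difference_binomial_sum ..
  finally show ?thesis by simp
qed

text \<open>
  Both sides are products of \<open>n\<close> factors in \<open>[-1, 1]\<close>, namely \<open>(k - i) / (N - i)\<close> and \<open>k / N\<close>, and corresponding
  factors differ by at most \<open>i / (N - i)\<close>.  The estimate is uniform in \<open>k\<close>, which is what allows it
  to be summed against weights of bounded total mass.
\<close>

lemma binomial_ratio_close:
  assumes n: "2 * n \<le> N" and N: "N > 0" and k: "k \<le> N"
  shows "\<bar>real (k choose n) / real (N choose n) - (real k / real N) ^ n\<bar> \<le> 2 * real n ^ 2 / real N"
proof -
  have "real (k choose n) / real (N choose n) = (\<Prod>i=0..<n. (real k - real i) / (real N - real i))"
    by (simp add: binomial_gbinomial gbinomial_prod_rev prod_dividef)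
  then have "\<bar>real (k choose n) / real (N choose n) - (real k / real N) ^ n\<bar>
    = norm ((\<Prod>i=0..<n. (real k - real i) / (real N - real i)) - (\<Prod>i=0..<n. real k / real N))"
    by simp
  also have "\<dots> \<le> (\<Sum>i=0..<n. norm ((real k - real i) / (real N - real i) - real k / real N))"
  proof (rule norm_prod_diff)
    fix i assume "i \<in> {0..<n}"
    then have i: "2 * real i \<le> real N" "real i < real N" "real k \<le> real N" using n N k by auto
    then show "norm ((real k - real i) / (real N - real i)) \<le> 1"
      by (simp add: abs_le_iff field_simps)
    show "norm (real k / real N) \<le> 1" using i by (simp add: field_simps)
  qed
  also have "\<dots> \<le> (\<Sum>i=0..<n. 2 * real n / real N)"
  proof (rule sum_mono)
    fix i assume "i \<in> {0..<n}"
    then have i: "2 * real i \<le> real N" "real i < real N" "real k \<le> real N" "real i \<le> real n" "real N > 0"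
      using n N k by auto
    have "(real k - real i) / (real N - real i) - real k / real N
      = - (real i / (real N - real i) * ((real N - real k) / real N))"
      using i by (simp add: field_simps)
    also have "norm \<dots> = real i / (real N - real i) * ((real N - real k) / real N)"
      using i by (simp add: abs_mult)
    also have "\<dots> \<le> (2 * real n / real N) * 1"
    proof (rule mult_mono)
      have "real i * real N \<le> 2 * (real i * (real N - real i))"
        using mult_left_mono[OF i(1), of "real i"] by (simp add: algebra_simps)
      also have "\<dots> \<le> 2 * (real n * (real N - real i))"
        using i by (intro mult_left_mono mult_right_mono) auto
      finally show "real i / (real N - real i) \<le> 2 * real n / real N"
        using i by (simp add: field_simps)
    qed (use i in auto)
    finally show "norm ((real k - real i) / (real N - real i) - real k / real N) \<le> 2 * real n / real N" by simp
  qed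
  also have "\<dots> = 2 * real n ^ 2 / real N" by (simp add: power2_eq_square)
  finally show ?thesis .
qed

text \<open>
  The finite form of Hausdorff's moment theorem: exact factorial moments and the uniform estimate for \<open>(k choose n) / (N choose n)\<close>.
\<close>

lemma moment_sequence_approximation:
  fixes a :: "nat \<Rightarrow> real"
  assumes a: "\<And>j k. difference a j k \<ge> 0" and e: "e > 0"
  shows "\<exists>N w. N > 0 \<and> (\<forall>k. w k \<ge> 0) \<and> (\<Sum>k\<le>N. w k) = a 0 \<and>
    (\<forall>n\<le>M. \<bar>a n - (\<Sum>k\<le>N. w k * (real k / real N) ^ n)\<bar> \<le> e)"
proof -
  have a0: "a 0 \<ge> 0" using a[of 0 0] by simp
  obtain N0 :: nat where N0: "a 0 * (2 * real M ^ 2) / e < real N0" using reals_Archimedean2 by blast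
  define N where "N = N0 + 2 * M + 1"
  define w where "w k = real (N choose k) * difference a (N - k) k" for k
  have w: "w k \<ge> 0" for k using a by (simp add: w_def)
  have N: "N > 0" "2 * M \<le> N" by (auto simp: N_def)
  have "a 0 * (2 * real M ^ 2) / e \<le> real N" using N0 by (simp add: N_def)
  then have small: "a 0 * (2 * real M ^ 2 / real N) \<le> e" using e N by (simp add: field_simps)
  have sum_w: "(\<Sum>k\<le>N. w k) = a 0"
    using factorial_moment[of 0 N a] by (simp add: w_def)
  have "\<bar>a n - (\<Sum>k\<le>N. w k * (real k / real N) ^ n)\<bar> \<le> e" if n: "n \<le> M" for n
  proof -
    have nN: "2 * n \<le> N" "n \<le> N" using n N by auto
    have "a n = (\<Sum>k\<le>N. w k * real (k choose n)) / real (N choose n)"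
      using factorial_moment[OF nN(2), of a] nN by (simp add: w_def field_simps)
    then have "a n - (\<Sum>k\<le>N. w k * (real k / real N) ^ n)
      = (\<Sum>k\<le>N. w k * (real (k choose n) / real (N choose n) - (real k / real N) ^ n))"
      by (simp add: sum_divide_distrib sum_subtractf right_diff_distrib)
    also have "\<bar>\<dots>\<bar> \<le> (\<Sum>k\<le>N. \<bar>w k * (real (k choose n) / real (N choose n) - (real k / real N) ^ n)\<bar>)"
      by (rule sum_abs)
    also have "\<dots> \<le> (\<Sum>k\<le>N. w k * (2 * real M ^ 2 / real N))"
    proof (rule sum_mono)
      fix k assume "k \<in> {..N}"
      then have "\<bar>real (k choose n) / real (N choose n) - (real k / real N) ^ n\<bar> \<le> 2 * real n ^ 2 / real N"
        using nN N by (intro binomial_ratio_close) auto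
      also have "\<dots> \<le> 2 * real M ^ 2 / real N"
        using n by (intro divide_right_mono mult_left_mono power_mono) auto
      finally show "\<bar>w k * (real (k choose n) / real (N choose n) - (real k / real N) ^ n)\<bar>
          \<le> w k * (2 * real M ^ 2 / real N)"
        using w[of k] by (simp only: abs_mult abs_of_nonneg mult_left_mono)
    qed
    also have "\<dots> = a 0 * (2 * real M ^ 2 / real N)"
      unfolding sum_distrib_right[symmetric] sum_w ..
    finally show ?thesis using small by simp
  qed
  then show ?thesis using N w sum_w by blast
qed

text \<open>
  The power \<open>(k / N)\<^sup>n\<close> is the value at \<open>n \<delta>\<close> of an exponential with rate \<open>ln (N / k) / \<delta> \<ge> 0\<close>.  The atom
  \<open>k = 0\<close> only contributes at \<open>n = 0\<close> and is dropped; therefore the grid starts at \<open>n = 1\<close>.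
\<close>

lemma exponential_sum_at_grid:
  assumes g: "completely_monotone g" and x: "x > 0" and d: "\<delta> > 0" and e: "e > 0"
  shows "\<exists>A w. finite A \<and> (\<forall>a\<in>A. a \<ge> 0 \<and> w a > 0) \<and> (\<Sum>a\<in>A. w a) \<le> g x \<and>
    (\<forall>n\<in>{1..M}. \<bar>g (x + real n * \<delta>) - (\<Sum>a\<in>A. w a * exp (- a * (real n * \<delta>)))\<bar> \<le> e)"
proof -
  obtain N w where N: "N > 0" and w': "\<forall>k. w k \<ge> 0"
    and sum_w: "(\<Sum>k\<le>N. w k) = g (x + real 0 * \<delta>)"
    and close': "\<forall>n\<le>M. \<bar>g (x + real n * \<delta>) - (\<Sum>k\<le>N. w k * (real k / real N) ^ n)\<bar> \<le> e"
    using moment_sequence_approximation[of "\<lambda>k. g (x + real k * \<delta>)" e M,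
        OF difference_completely_monotone[OF g x d] e] by (elim exE conjE) (rule that)
  note w = w'[rule_format] and close = close'[rule_format]
  \<comment> \<open>Zero weights are dropped, since the partial fractions need positive ones.\<close>
  define K where "K = {k \<in> {1..N}. w k > 0}"
  define \<mu> where "\<mu> k = ln (real N / real k) / \<delta>" for k :: nat
  have K: "finite K" "K \<subseteq> {..N}" by (auto simp: K_def)
  have inj: "inj_on \<mu> K"
    using d N by (auto simp: inj_on_def \<mu>_def K_def divide_simps)
  define A where "A = \<mu> ` K"
  define v where "v a = w (the_inv_into K \<mu> a)" for a
  have v: "v (\<mu> k) = w k" if "k \<in> K" for k
    using the_inv_into_f_f[OF inj that] by (simp add: v_def)
  have sumA: "(\<Sum>a\<in>A. v a * F a) = (\<Sum>k\<in>K. w k * F (\<mu> k))" for F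
    unfolding A_def using v by (simp add: sum.reindex[OF inj])
  show ?thesis
  proof (intro exI conjI ballI)
    show "finite A" using K by (simp add: A_def)
    fix a assume "a \<in> A"
    then obtain k where k: "k \<in> K" "a = \<mu> k" by (auto simp: A_def)
    show "a \<ge> 0" using k d N by (auto simp: \<mu>_def K_def)
    show "v a > 0" using k v by (auto simp: K_def)
  next
    have "(\<Sum>a\<in>A. v a) = (\<Sum>k\<in>K. w k)" using sumA[of "\<lambda>_. 1"] by simp
    also have "\<dots> \<le> (\<Sum>k\<le>N. w k)" using K w by (intro sum_mono2) auto
    finally show "(\<Sum>a\<in>A. v a) \<le> g x" using sum_w by simp
  next
    fix n assume n: "n \<in> {1..M}"
    have pow: "exp (- \<mu> k * (real n * \<delta>)) = (real k / real N) ^ n" if k: "k \<in> K" for k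
    proof -
      have k0: "real k > 0" using k by (auto simp: K_def)
      have "\<mu> k * \<delta> = - ln (real k / real N)"
        using k0 N d by (simp add: \<mu>_def ln_div)
      then have "- \<mu> k * (real n * \<delta>) = real n * ln (real k / real N)"
        by (simp add: mult.left_commute)
      then show ?thesis using k0 N by (simp add: exp_of_nat_mult)
    qed
    have "(\<Sum>a\<in>A. v a * exp (- a * (real n * \<delta>))) = (\<Sum>k\<in>K. w k * (real k / real N) ^ n)"
      unfolding sumA[of "\<lambda>a. exp (- a * (real n * \<delta>))"] using pow by (intro sum.cong) auto
    also have "\<dots> = (\<Sum>k\<le>N. w k * (real k / real N) ^ n)"
    proof (rule sum.mono_neutral_left)
      show "\<forall>k\<in>{..N} - K. w k * (real k / real N) ^ n = 0"
      proof
        fix k assume k: "k \<in> {..N} - K"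
        then have "k = 0 \<or> w k = 0" using w[of k] by (auto simp: K_def)
        then show "w k * (real k / real N) ^ n = 0" using n by auto
      qed
    qed (use K in auto)
    finally show "\<bar>g (x + real n * \<delta>) - (\<Sum>a\<in>A. v a * exp (- a * (real n * \<delta>)))\<bar> \<le> e"
      using close[of n] n by simp
  qed
qed

text \<open>
  Mesh \<open>1 / (m + 1)\<close> on a grid reaching up to \<open>m + 1\<close>.  Both \<open>g\<close> and the exponential sums are decreasing, so closeness at
  the two grid points around \<open>t\<close> squeezes the sum at \<open>t\<close> between shifted values of \<open>g\<close>.
\<close>

lemma exponential_sums_converge:
  assumes g: "completely_monotone g" and x: "x > 0"
  shows "\<exists>A w. (\<forall>m::nat. finite (A m) \<and> (\<forall>a\<in>A m. a \<ge> 0 \<and> w m a > 0) \<and> (\<Sum>a\<in>A m. w m a) \<le> g x) \<and>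
    (\<forall>t>0. (\<lambda>m. \<Sum>a\<in>A m. w m a * exp (- a * t)) \<longlonglongrightarrow> g (x + t))"
proof -
  define \<delta> where "\<delta> m = inverse (real (Suc m))" for m
  have d: "\<delta> m > 0" for m by (simp add: \<delta>_def)
  define Q where "Q m A w \<longleftrightarrow> finite A \<and> (\<forall>a\<in>A. a \<ge> 0 \<and> w a > 0) \<and> (\<Sum>a\<in>A. w a) \<le> g x \<and>
    (\<forall>n\<in>{1..Suc m * Suc m}.
      \<bar>g (x + real n * \<delta> m) - (\<Sum>a\<in>A. w a * exp (- a * (real n * \<delta> m)))\<bar> \<le> \<delta> m)"
    for m and A :: "real set" and w
  have "\<forall>m. \<exists>A w. Q m A w"
    unfolding Q_def by (intro allI exponential_sum_at_grid[OF g x d d])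
  from choice[OF this] obtain A where "\<forall>m. \<exists>w. Q m (A m) w" ..
  from choice[OF this] obtain w where Q: "\<forall>m. Q m (A m) (w m)" ..
  have A: "finite (A m)" "\<And>a. a \<in> A m \<Longrightarrow> a \<ge> 0 \<and> w m a > 0"
    "(\<Sum>a\<in>A m. w m a) \<le> g x" for m
    using Q unfolding Q_def by auto
  have close: "\<bar>g (x + real n * \<delta> m) - (\<Sum>a\<in>A m. w m a * exp (- a * (real n * \<delta> m)))\<bar> \<le> \<delta> m"
    if "n \<in> {1..Suc m * Suc m}" for m n
    using Q that unfolding Q_def by blast
  define E where "E m t = (\<Sum>a\<in>A m. w m a * exp (- a * t))" for m t
  have E_anti: "E m t \<le> E m s" if "s \<le> t" for m s t
    unfolding E_def
  proof (rule sum_mono)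
    fix a assume "a \<in> A m"
    then have "a \<ge> 0" "w m a > 0" using A(2) by auto
    then show "w m a * exp (- a * t) \<le> w m a * exp (- a * s)"
      using that by (auto intro: mult_left_mono)
  qed
  have lim: "(\<lambda>m. E m t) \<longlonglongrightarrow> g (x + t)" if t: "t > 0" for t
  proof (rule tendsto_sandwich)
    obtain m0 :: nat where m0: "max t (1 / t) < real m0" using reals_Archimedean2 by blast
    have bounds: "g (x + t + \<delta> m) - \<delta> m \<le> E m t \<and> E m t \<le> g (x + t - \<delta> m) + \<delta> m" if m: "m \<ge> m0" for m
    proof -
      define n where "n = nat \<lfloor>t * real (Suc m)\<rfloor>"
      have tm: "t \<le> real m" "1 / t \<le> real m" using m0 m by linarith+
      have "1 \<le> t * real m" using tm(2) t by (simp add: field_simps)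
      also have "\<dots> \<le> t * real (Suc m)" using t by simp
      finally have one: "1 \<le> t * real (Suc m)" .
      have "real n = of_int \<lfloor>t * real (Suc m)\<rfloor>"
        using one by (simp add: n_def)
      then have n: "real n \<le> t * real (Suc m)" "t * real (Suc m) < real n + 1" by linarith+
      have n1: "n \<ge> 1" using one n by linarith
      have "t * real (Suc m) \<le> real m * real (Suc m)" using tm(1) by (intro mult_right_mono) auto
      then have "real n + 1 \<le> real m * real (Suc m) + 1" using n(1) by linarith
      also have "\<dots> \<le> real (Suc m * Suc m)" by (simp add: algebra_simps)
      finally have n2: "Suc n \<le> Suc m * Suc m" by linarith
      have nd: "real n * \<delta> m \<le> t" "t \<le> real (Suc n) * \<delta> m"
        using n by (simp_all add: \<delta>_def field_simps)
      have nd': "t - \<delta> m \<le> real n * \<delta> m" "real (Suc n) * \<delta> m \<le> t + \<delta> m"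
        using nd by (simp_all add: algebra_simps)
      have dt: "\<delta> m \<le> t" using one by (simp add: \<delta>_def field_simps)
      have "E m t \<le> E m (real n * \<delta> m)" by (rule E_anti[OF nd(1)])
      also have "\<dots> \<le> g (x + real n * \<delta> m) + \<delta> m"
        using close[of n m] n1 n2 unfolding E_def by (simp add: abs_le_iff)
      also have "g (x + real n * \<delta> m) \<le> g (x + t - \<delta> m)"
        using x dt nd' by (intro completely_monotone_antimono[OF g]) auto
      finally have upper: "E m t \<le> g (x + t - \<delta> m) + \<delta> m" by simp
      have "g (x + t + \<delta> m) \<le> g (x + real (Suc n) * \<delta> m)"
        using x d[of m] nd'(2) by (intro completely_monotone_antimono[OF g]) (auto intro: add_pos_nonneg)
      also have "\<dots> \<le> E m (real (Suc n) * \<delta> m) + \<delta> m"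
        using close[of "Suc n" m] n2 unfolding E_def by (simp add: abs_le_iff del: of_nat_Suc)
      also have "E m (real (Suc n) * \<delta> m) \<le> E m t" by (rule E_anti[OF nd(2)])
      finally show ?thesis using upper by simp
    qed
    show "\<forall>\<^sub>F m in sequentially. g (x + t + \<delta> m) - \<delta> m \<le> E m t"
      using bounds by (auto simp: eventually_sequentially)
    show "\<forall>\<^sub>F m in sequentially. E m t \<le> g (x + t - \<delta> m) + \<delta> m"
      using bounds by (auto simp: eventually_sequentially)
    have d0: "\<delta> \<longlonglongrightarrow> 0" unfolding \<delta>_def by (rule LIMSEQ_inverse_real_of_nat)
    have cont: "isCont g (x + t)" using x t by (intro completely_monotone_isCont[OF g]) auto
    have "(\<lambda>m. g (x + t + \<delta> m) - \<delta> m) \<longlonglongrightarrow> g (x + t) - 0"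
      by (intro tendsto_diff d0 isCont_tendsto_compose[OF cont]) (use tendsto_add[OF tendsto_const d0] in simp)
    then show "(\<lambda>m. g (x + t + \<delta> m) - \<delta> m) \<longlonglongrightarrow> g (x + t)" by simp
    have "(\<lambda>m. g (x + t - \<delta> m) + \<delta> m) \<longlonglongrightarrow> g (x + t) + 0"
      by (intro tendsto_add[OF _ d0] isCont_tendsto_compose[OF cont]) (use tendsto_diff[OF tendsto_const d0] in simp)
    then show "(\<lambda>m. g (x + t - \<delta> m) + \<delta> m) \<longlonglongrightarrow> g (x + t)" by simp
  qed
  show ?thesis
    by (rule exI[of _ A], rule exI[of _ w]) (use A lim in \<open>auto simp: E_def\<close>)
qed

section \<open>The reciprocal of the transform of a completely monotone function\<close>

lemma bernstein_transform_reciprocal_exponential_sum: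
  fixes A :: "real set"
  assumes "finite A" "\<And>a. a \<in> A \<Longrightarrow> a \<ge> 0 \<and> w a > 0" "b > 0"
  shows "bernstein_transform (\<lambda>p. 1 / (p * (b + (\<Sum>a\<in>A. w a / (p + a)))))"
proof -
  obtain R c where R: "finite R" "\<And>r. r \<in> R \<Longrightarrow> r \<ge> 0 \<and> c r \<ge> 0"
    and eq: "\<And>p. p > 0 \<Longrightarrow> 1 / (p * (b + (\<Sum>a\<in>A. w a / (p + a)))) = (\<Sum>r\<in>R. c r / (p + r))"
    using reciprocal_partial_fractions[of A w b] assms by blast
  have "bernstein_transform (\<lambda>p. \<Sum>r\<in>R. c r * (1 / (p + r)))"
    using R by (intro bernstein_transform_sum bernstein_transform_simple_fraction) auto
  then show ?thesis
    by (subst bernstein_transform_cong[OF eq]) auto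
qed

lemma laplace_exponential_sum:
  assumes "finite A" "\<And>a. a \<in> A \<Longrightarrow> a \<ge> 0" "p > 0"
  shows "laplace_exists (\<lambda>t. \<Sum>a\<in>A. w a * exp (- a * t)) p \<and>
    laplace (\<lambda>t. \<Sum>a\<in>A. w a * exp (- a * t)) p = (\<Sum>a\<in>A. w a / (p + a))"
  using assms(1,2)
proof (induction A rule: finite_induct)
  case empty
  then show ?case by (simp add: laplace_const(1)[OF assms(3)] laplace_def)
next
  case (insert a A)
  have "p + a > 0" using insert assms(3) by (simp add: add_pos_nonneg)
  note e = laplace_exp[OF this]
  have IH: "laplace_exists (\<lambda>t. \<Sum>a\<in>A. w a * exp (- a * t)) p"
    "laplace (\<lambda>t. \<Sum>a\<in>A. w a * exp (- a * t)) p = (\<Sum>a\<in>A. w a / (p + a))"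
    using insert by auto
  show ?case
    unfolding sum.insert[OF insert(1,2)]
    using laplace_add_scale[OF e(1) IH(1), of "w a"] e(2) IH(2) by simp
qed

text \<open>
  The shift \<open>x\<close> makes \<open>g (x + t)\<close> bounded by \<open>g x\<close>, which bounds the approximating sums as well, so their
  transforms converge by dominated convergence.
\<close>

lemma bernstein_transform_reciprocal_shifted:
  assumes g: "completely_monotone g" and x: "x > 0" and b: "b > 0"
  shows "bernstein_transform (\<lambda>p. 1 / (p * (b + laplace (\<lambda>t. g (x + t)) p)))"
proof -
  obtain A w where Aw: "\<forall>m::nat. finite (A m) \<and> (\<forall>a\<in>A m. a \<ge> 0 \<and> w m a > 0) \<and> (\<Sum>a\<in>A m. w m a) \<le> g x"
    and lim': "\<forall>t>0. (\<lambda>m. \<Sum>a\<in>A m. w m a * exp (- a * t)) \<longlonglongrightarrow> g (x + t)"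
    using exponential_sums_converge[OF g x] by (elim exE conjE) (rule that)
  have A: "finite (A m)" "\<And>a. a \<in> A m \<Longrightarrow> a \<ge> 0 \<and> w m a > 0"
    "(\<Sum>a\<in>A m. w m a) \<le> g x" for m
    using Aw by auto
  note lim = lim'[rule_format]
  show ?thesis
  proof (rule bernstein_transform_limit)
    show "bernstein_transform (\<lambda>p. 1 / (p * (b + (\<Sum>a\<in>A m. w m a / (p + a)))))" for m
      using A b by (intro bernstein_transform_reciprocal_exponential_sum) auto
    fix p :: real assume p: "p > 0"
    have ex: "laplace_exists (\<lambda>t. \<Sum>a\<in>A m. w m a * exp (- a * t)) p"
      "laplace (\<lambda>t. \<Sum>a\<in>A m. w m a * exp (- a * t)) p = (\<Sum>a\<in>A m. w m a / (p + a))" for m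
      using laplace_exponential_sum[OF A(1)[of m] _ p, of "w m"] A(2)[of _ m] by auto
    have bound: "\<bar>\<Sum>a\<in>A m. w m a * exp (- a * t)\<bar> \<le> g x" if t: "t > 0" for m t
    proof -
      have "\<bar>\<Sum>a\<in>A m. w m a * exp (- a * t)\<bar> \<le> (\<Sum>a\<in>A m. \<bar>w m a * exp (- a * t)\<bar>)"
        by (rule sum_abs)
      also have "\<dots> \<le> (\<Sum>a\<in>A m. w m a)"
      proof (rule sum_mono)
        fix a assume "a \<in> A m"
        then have "w m a > 0" "exp (- a * t) \<le> 1" using A(2)[of a m] t by auto
        then show "\<bar>w m a * exp (- a * t)\<bar> \<le> w m a"
          by (simp add: abs_mult)
      qed
      also have "\<dots> \<le> g x" by (rule A(3))
      finally show ?thesis .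
    qed
    have L: "(\<lambda>m. \<Sum>a\<in>A m. w m a / (p + a)) \<longlonglongrightarrow> laplace (\<lambda>t. g (x + t)) p"
      using laplace_dominated_convergence(2)[OF ex(1) laplace_const(1)[OF p] lim bound]
      unfolding ex(2) by simp
    have "laplace (\<lambda>t. g (x + t)) p \<ge> 0"
      by (rule LIMSEQ_le_const[OF L])
        (use A(2) p in \<open>auto intro!: sum_nonneg divide_nonneg_nonneg simp: less_imp_le\<close>)
    then have "p * (b + laplace (\<lambda>t. g (x + t)) p) \<noteq> 0" using p b by (simp add: add_pos_nonneg less_imp_neq[symmetric])
    then show "(\<lambda>m. 1 / (p * (b + (\<Sum>a\<in>A m. w m a / (p + a)))))
        \<longlonglongrightarrow> 1 / (p * (b + laplace (\<lambda>t. g (x + t)) p))"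
      by (intro tendsto_intros L)
  qed
qed

lemma licm_completely_monotone: "licm f \<Longrightarrow> completely_monotone f"
  unfolding licm_def completely_monotone_def by blast

lemma completely_monotone_continuous_on:
  assumes "completely_monotone f" "A \<subseteq> {0<..}"
  shows "continuous_on A f"
  using assms completely_monotone_isCont by (intro continuous_at_imp_continuous_on) auto

text \<open>
  Near 0 the assumed integrability dominates the integrand, and away from 0 the function is bounded by monotonicity.
\<close>

lemma licm_laplace_exists:
  assumes f: "licm f" and p: "p > 0"
  shows "laplace_exists f p"
proof -
  have cm: "completely_monotone f" using f by (rule licm_completely_monotone)
  obtain e where e: "e > 0" "set_integrable lborel {0<..<e} f" using f unfolding licm_def by auto
  have meas: "set_borel_measurable lborel A (\<lambda>t. exp (- p * t) * f t)"
    if "A \<in> sets borel" "A \<subseteq> {0<..}" for A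
  proof -
    have "set_borel_measurable borel A (\<lambda>t. exp (- p * t) * f t)"
      using that by (intro set_measurable_continuous_on continuous_intros completely_monotone_continuous_on[OF cm])
    then show ?thesis unfolding set_borel_measurable_def by simp
  qed
  have "set_integrable lborel {0<..<e} (\<lambda>t. exp (- p * t) * f t)"
  proof (rule set_integrable_bound[OF e(2) meas])
    show "AE x in lborel. x \<in> {0<..<e} \<longrightarrow> norm (exp (- p * x) * f x) \<le> norm (f x)"
    proof (intro AE_I2 impI)
      fix x assume "x \<in> {0<..<e}"
      then have "\<bar>exp (- p * x)\<bar> \<le> 1" using p by simp
      then show "norm (exp (- p * x) * f x) \<le> norm (f x)"
        unfolding real_norm_def abs_mult by (intro mult_left_le_one_le) auto
    qed
  qed auto
  moreover have "set_integrable lborel {e/2<..} (\<lambda>t. exp (- p * t) * f t)"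
  proof (rule set_integrable_bound)
    show "set_integrable lborel {e/2<..} (\<lambda>t. f (e/2) * exp (- p * t))"
      using exp_integral_Ioi(1)[OF p] by (rule set_integrable_mult_right)
    show "AE x in lborel. x \<in> {e/2<..} \<longrightarrow> norm (exp (- p * x) * f x) \<le> norm (f (e/2) * exp (- p * x))"
    proof (intro AE_I2 impI)
      fix x assume "x \<in> {e/2<..}"
      then have "0 \<le> f x" "f x \<le> f (e/2)"
        using e completely_monotone_nonneg[OF cm, of x] completely_monotone_antimono[OF cm, of "e/2" x] by auto
      then show "norm (exp (- p * x) * f x) \<le> norm (f (e/2) * exp (- p * x))"
        by (simp add: abs_mult)
    qed
    show "set_borel_measurable lborel {e/2<..} (\<lambda>t. exp (- p * t) * f t)"
      using e by (intro meas) auto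
  qed
  ultimately have "set_integrable lborel ({0<..<e} \<union> {e/2<..}) (\<lambda>t. exp (- p * t) * f t)"
    by (rule set_integrable_Un) auto
  moreover have "{0<..<e} \<union> {e/2<..} = {0<..}" using e by auto
  ultimately show ?thesis unfolding laplace_exists_def by simp
qed

lemma laplace_lower_bound:
  assumes f: "completely_monotone f" and L: "laplace_exists f p" and p: "p > 0" and d: "d > 0"
  shows "f d * (1 - exp (- p * d)) \<le> p * laplace f p"
proof -
  have t: "laplace_exists (indicator {d<..}) p" "laplace (indicator {d<..}) p = exp (- p * d) / p"
    using laplace_tail[OF p, of d] d by auto
  have "laplace (\<lambda>t. - f d * indicator {d<..} t + f d) p \<le> laplace f p"
  proof (rule laplace_mono[OF _ L])
    show "laplace_exists (\<lambda>t. - f d * indicator {d<..} t + f d) p"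
      by (rule laplace_add_scale[OF t(1) laplace_const(1)[OF p]])
    fix t :: real assume "t > 0"
    then show "- f d * indicator {d<..} t + f d \<le> f t"
      using completely_monotone_antimono[OF f, of t d] completely_monotone_nonneg[OF f, of t]
      by (auto simp: indicator_def)
  qed
  also have "laplace (\<lambda>t. - f d * indicator {d<..} t + f d) p = f d * (1 - exp (- p * d)) / p"
    unfolding laplace_add_scale(2)[OF t(1) laplace_const(1)[OF p]] t(2) laplace_const(2)[OF p]
    using p by (simp add: field_simps)
  finally show ?thesis using p by (simp add: field_simps)
qed

lemma laplace_pos:
  assumes f: "completely_monotone f" and L: "laplace_exists f p" and p: "p > 0"
    and d: "d > 0" "f d \<noteq> 0"
  shows "laplace f p > 0"
proof -
  have "f d > 0" using completely_monotone_nonneg[OF f d(1)] d(2) by simp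
  then have "f d * (1 - exp (- p * d)) > 0" using p d by simp
  also have "\<dots> \<le> p * laplace f p" by (rule laplace_lower_bound[OF f L p d(1)])
  finally show ?thesis using p by (simp add: zero_less_mult_iff)
qed

lemma laplace_le_bound:
  assumes "laplace_exists f p" "p > 0" "\<And>t. t > 0 \<Longrightarrow> f t \<le> c"
  shows "p * laplace f p \<le> c"
  using laplace_mono[OF assms(1) laplace_const(1)[OF assms(2)] assms(3)] laplace_const(2)[OF assms(2)] assms(2)
  by (simp add: field_simps)

lemma laplace_ge_bound:
  assumes "laplace_exists f p" "p > 0" "\<And>t. t > 0 \<Longrightarrow> c \<le> f t"
  shows "c \<le> p * laplace f p"
  using laplace_mono[OF laplace_const(1)[OF assms(2)] assms(1) assms(3)] laplace_const(2)[OF assms(2)] assms(2)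
  by (simp add: field_simps)

text \<open>
  Beyond \<open>T\<close> the function is at most \<open>f T\<close>, and up to \<open>T\<close> the integrand is at most \<open>exp (T - t) * f t\<close>
  for every \<open>p\<close>.  The second contribution is multiplied by \<open>p\<close> and so disappears as \<open>p\<close> tends to 0.
\<close>

lemma laplace_small_argument_bound:
  assumes f: "completely_monotone f" and L: "laplace_exists f p" "laplace_exists f 1"
    and p: "0 < p" and T: "T > 0"
  shows "p * laplace f p \<le> f T + p * (exp T * laplace f 1)"
proof -
  have "laplace f p \<le> (LINT t:{0<..}|lborel. f T * exp (- p * t) + exp T * (exp (- 1 * t) * f t))"
    unfolding laplace_def
  proof (rule set_integral_mono)
    show "set_integrable lborel {0<..} (\<lambda>t. f T * exp (- p * t) + exp T * (exp (- 1 * t) * f t))"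
      using exp_integral_Ioi(1)[OF p, of 0] L(2) unfolding laplace_exists_def
      by (intro set_integral_add set_integrable_mult_right)
    fix t :: real assume "t \<in> {0<..}"
    then have t: "t > 0" by simp
    have f0: "f t \<ge> 0" "f T \<ge> 0" using completely_monotone_nonneg[OF f] t T by auto
    show "exp (- p * t) * f t \<le> f T * exp (- p * t) + exp T * (exp (- 1 * t) * f t)"
    proof (cases "t \<le> T")
      case True
      have "- p * t \<le> 0" using p t by simp
      then have "exp (- p * t) \<le> exp (T - t)" using True by (simp only: exp_le_cancel_iff)
      also have "\<dots> = exp T * exp (- 1 * t)" by (simp add: exp_diff exp_minus field_simps)
      finally have "exp (- p * t) * f t \<le> exp T * exp (- 1 * t) * f t" using f0(1) by (rule mult_right_mono)
      then show ?thesis using f0 by (simp add: mult.assoc add_increasing)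
    next
      case False
      then have "f t \<le> f T" using T by (intro completely_monotone_antimono[OF f]) auto
      then have "exp (- p * t) * f t \<le> f T * exp (- p * t)" by simp
      moreover have "exp T * (exp (- 1 * t) * f t) \<ge> 0" using f0 by simp
      ultimately show ?thesis by linarith
    qed
  qed (use L(1) in \<open>simp add: laplace_exists_def\<close>)
  also have "\<dots> = f T / p + exp T * laplace f 1"
    using exp_integral_Ioi[OF p, of 0] L(2) unfolding laplace_exists_def laplace_def
    by (subst set_integral_add) auto
  finally show ?thesis using p by (simp add: field_simps)
qed

text \<open>
  The shifts \<open>1 / (m + 1)\<close> tend to 0 and \<open>f\<close> dominates its shifts.  Adding the same quantity to \<open>\<beta>\<close> keeps the constant
  positive along the way, which the exponential sums require.
\<close>

lemma bernstein_transform_reciprocal: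
  assumes f: "licm f" and nz: "d > 0" "f d \<noteq> 0" and \<beta>: "\<beta> \<ge> 0"
  shows "bernstein_transform (\<lambda>p. 1 / (p * (laplace f p + \<beta>)))"
proof (rule bernstein_transform_limit)
  have cm: "completely_monotone f" using f by (rule licm_completely_monotone)
  let ?x = "\<lambda>m. inverse (real (Suc m))"
  show "bernstein_transform (\<lambda>p. 1 / (p * ((\<beta> + ?x m) + laplace (\<lambda>t. f (?x m + t)) p)))" for m
    using \<beta> by (intro bernstein_transform_reciprocal_shifted[OF cm]) (auto intro: add_nonneg_pos)
  fix p :: real assume p: "p > 0"
  have x0: "?x \<longlonglongrightarrow> 0" by (rule LIMSEQ_inverse_real_of_nat)
  have L: "(\<lambda>m. laplace (\<lambda>t. f (?x m + t)) p) \<longlonglongrightarrow> laplace f p"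
  proof (rule laplace_dominated_convergence(2)[OF _ licm_laplace_exists[OF f p]])
    fix m
    show "laplace_exists (\<lambda>t. f (?x m + t)) p"
    proof (rule laplace_existsI[where q = p and C = "f (?x m)"])
      show "continuous_on {0<..} (\<lambda>t. f (?x m + t))"
        by (rule continuous_on_compose2[OF completely_monotone_continuous_on[OF cm, of "{0<..}"]])
          (auto intro!: continuous_intros add_pos_pos)
      fix t :: real assume t: "t > 0"
      then have "0 \<le> f (?x m + t)" "f (?x m + t) \<le> f (?x m)"
        using completely_monotone_nonneg[OF cm, of "?x m + t"]
          completely_monotone_antimono[OF cm, of "?x m" "?x m + t"] by (auto simp: add_pos_pos)
      then show "\<bar>exp (- p * t) * f (?x m + t)\<bar> \<le> f (?x m) * exp (- p * t)"
        by (simp add: abs_mult)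
    qed (rule p)
    fix t :: real assume t: "t > 0"
    then show "\<bar>f (?x m + t)\<bar> \<le> f t"
      using completely_monotone_nonneg[OF cm, of "?x m + t"]
        completely_monotone_antimono[OF cm, of t "?x m + t"] by (simp add: add_pos_pos)
  next
    fix t :: real assume t: "t > 0"
    show "(\<lambda>m. f (?x m + t)) \<longlonglongrightarrow> f t"
      by (rule isCont_tendsto_compose[OF completely_monotone_isCont[OF cm t]])
        (use tendsto_add[OF x0 tendsto_const[of t]] in simp)
  qed
  have "(\<lambda>m. 1 / (p * ((\<beta> + ?x m) + laplace (\<lambda>t. f (?x m + t)) p)))
      \<longlonglongrightarrow> 1 / (p * ((\<beta> + 0) + laplace f p))"
    using laplace_pos[OF cm licm_laplace_exists[OF f p] p nz] p \<beta>
    by (intro tendsto_intros x0 L) (auto simp: add_nonneg_pos less_imp_neq[symmetric])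
  then show "(\<lambda>m. 1 / (p * ((\<beta> + ?x m) + laplace (\<lambda>t. f (?x m + t)) p)))
      \<longlonglongrightarrow> 1 / (p * (laplace f p + \<beta>))"
    by (simp add: add.commute[of \<beta> "laplace f p"])
qed

section \<open>Values at zero and at infinity\<close>

lemma antimono_tendsto_at_top:
  fixes f :: "real \<Rightarrow> real"
  assumes mono: "\<And>s t. 0 < s \<Longrightarrow> s \<le> t \<Longrightarrow> f t \<le> f s" and nonneg: "\<And>t. t > 0 \<Longrightarrow> 0 \<le> f t"
  shows "\<exists>L\<ge>0. (f \<longlongrightarrow> L) at_top \<and> (\<forall>t>0. L \<le> f t)"
proof -
  define L where "L = Inf (f ` {0<..})"
  have bdd: "bdd_below (f ` {0<..})" using nonneg by (intro bdd_belowI[of _ 0]) auto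
  have le: "L \<le> f t" if "t > 0" for t unfolding L_def using bdd that by (intro cInf_lower) auto
  have "L \<ge> 0" unfolding L_def using nonneg by (intro cInf_greatest) auto
  moreover have "(f \<longlongrightarrow> L) at_top"
  proof (rule order_tendstoI)
    fix a assume "a < L"
    then show "\<forall>\<^sub>F x in at_top. a < f x"
      using le by (intro eventually_at_top_linorderI[of 1]) (smt (verit))
  next
    fix a assume "L < a"
    then obtain T where T: "T > 0" "f T < a"
      unfolding L_def using cInf_less_iff[OF _ bdd, of a] by auto
    then show "\<forall>\<^sub>F x in at_top. f x < a"
      using mono by (intro eventually_at_top_linorderI[of T]) (smt (verit))
  qed
  ultimately show ?thesis using le by blast
qed

lemma antimono_tendsto_at_right:
  fixes f :: "real \<Rightarrow> real"
  assumes mono: "\<And>s t. 0 < s \<Longrightarrow> s \<le> t \<Longrightarrow> f t \<le> f s"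
  shows "((\<lambda>t. ereal (f t)) \<longlongrightarrow> (SUP t\<in>{0<..}. ereal (f t))) (at_right 0)"
proof (rule order_tendstoI)
  fix a assume "a < (SUP t\<in>{0<..}. ereal (f t))"
  then obtain d where d: "d > 0" "a < ereal (f d)" unfolding less_SUP_iff by auto
  show "\<forall>\<^sub>F t in at_right 0. a < ereal (f t)"
    unfolding eventually_at_right_field
    using d mono by (intro exI[of _ d]) (auto intro: less_le_trans)
next
  fix a assume a: "(SUP t\<in>{0<..}. ereal (f t)) < a"
  have "ereal (f t) < a" if "t > 0" for t
    using a that by (intro le_less_trans[OF SUP_upper a]) auto
  then show "\<forall>\<^sub>F t in at_right 0. ereal (f t) < a"
    unfolding eventually_at_right_field by (intro exI[of _ 1]) auto
qed

lemma bernstein_laplace_le: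
  assumes h: "bernstein h" and p: "p > 0" and d: "d > 0"
  shows "p * laplace h p \<le> h d * (1 + 4 / (p * d))"
proof -
  have lin: "laplace_exists (\<lambda>t. 1 + t / d) p" by (rule laplace_linear[OF p d])
  note s = laplace_add_scale[OF lin laplace_const(1)[OF p], of "h d" 0]
  have "laplace h p \<le> laplace (\<lambda>t. h d * (1 + t / d) + 0) p"
    using d bernstein_linear_bound[OF h]
    by (intro laplace_mono[OF bernstein_laplace_exists[OF h p] s(1)]) auto
  also have "\<dots> = h d * laplace (\<lambda>t. 1 + t / d) p"
    unfolding s(2) laplace_const(2)[OF p] by simp
  finally have "p * laplace h p \<le> p * (h d * laplace (\<lambda>t. 1 + t / d) p)"
    using p by (intro mult_left_mono) auto
  also have "\<dots> = h d * (p * laplace (\<lambda>t. 1 + t / d) p)" by simp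
  also have "\<dots> \<le> h d * (1 + 4 / (p * d))"
    using d by (intro mult_left_mono laplace_linear_le[OF p d] bernstein_nonneg[OF h]) auto
  finally show ?thesis .
qed

text \<open>
  The value \<open>h 0\<close> is a lower bound of \<open>p * laplace h p\<close>.
\<close>

lemma bernstein_initial_value_zero:
  assumes h: "bernstein h" and eq: "\<And>p. p > 0 \<Longrightarrow> u p > 0 \<and> p * laplace h p = 1 / u p"
    and unbounded: "\<And>K. \<exists>p>0. K < u p"
  shows "h 0 = 0"
proof (rule ccontr)
  assume "h 0 \<noteq> 0"
  then have h0: "h 0 > 0" using bernstein_nonneg[OF h, of 0] by simp
  obtain p where p: "p > 0" "1 / h 0 < u p" using unbounded by blast
  have "h 0 \<le> 1 / u p" using bernstein_le_laplace[OF h p(1), of 0] eq[OF p(1)] by simp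
  then show False using p(2) h0 eq[OF p(1)] by (simp add: field_simps)
qed

text \<open>
  For large \<open>p\<close>, \<open>p * laplace h p\<close> lies between \<open>h 0\<close> and nearly \<open>h d\<close>, while \<open>p * laplace f p\<close> lies between nearly
  \<open>f d\<close> and \<open>l\<close>, for each fixed \<open>d > 0\<close>.  As the product of the two is 1, this yields \<open>h 0 * f d \<le> 1 \<le> h d * l\<close>, and then
  \<open>d\<close> tends to 0.
\<close>

lemma bernstein_initial_value:
  assumes h: "bernstein h" and f: "completely_monotone f" and L: "\<And>p. p > 0 \<Longrightarrow> laplace_exists f p"
    and eq: "\<And>p. p > 0 \<Longrightarrow> laplace f p > 0 \<and> p * laplace h p = 1 / (p * laplace f p)"
    and le: "\<And>t. t > 0 \<Longrightarrow> f t \<le> l" and sup: "\<And>c. c < l \<Longrightarrow> \<exists>t>0. c < f t"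
  shows "h 0 = 1 / l"
proof -
  have u: "p * laplace f p \<le> l" if "p > 0" for p
    by (rule laplace_le_bound[OF L[OF that] that le])
  have l0: "l > 0" using u[of 1] eq[of 1] by simp
  have ge_d: "1 \<le> h d * l" if d: "d > 0" for d
  proof (rule LIMSEQ_le_const)
    show "(\<lambda>n. h d * (1 + 4 / d * inverse (real (Suc n))) * l) \<longlonglongrightarrow> h d * l"
      using tendsto_mult[OF tendsto_mult[OF tendsto_const tendsto_add[OF tendsto_const
            tendsto_mult[OF tendsto_const LIMSEQ_inverse_real_of_nat]]] tendsto_const,
          of "h d" 1 "4 / d" l] by simp
    show "\<exists>N. \<forall>n\<ge>N. 1 \<le> h d * (1 + 4 / d * inverse (real (Suc n))) * l"
    proof (intro exI[of _ 0] allI impI)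
      fix n
      define p where "p = real (Suc n)"
      have p: "p > 0" by (simp add: p_def)
      have "1 = (p * laplace h p) * (p * laplace f p)" using eq[OF p] p by simp
      also have "\<dots> \<le> (h d * (1 + 4 / (p * d))) * l"
        using p d eq[OF p] l0 bernstein_nonneg[OF h, of d]
        by (intro mult_mono bernstein_laplace_le[OF h] u) auto
      also have "4 / (p * d) = 4 / d * inverse p" by (simp add: field_simps)
      finally show "1 \<le> h d * (1 + 4 / d * inverse (real (Suc n))) * l" by (simp add: p_def)
    qed
  qed
  have "(h \<longlongrightarrow> h 0) (at_right 0)"
    using h unfolding bernstein_def continuous_on_def
    by (metis atLeast_iff at_within_Ici_at_right order_refl)
  then have "((\<lambda>d. h d * l) \<longlongrightarrow> h 0 * l) (at_right 0)" by (intro tendsto_intros)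
  moreover have "\<forall>\<^sub>F d in at_right 0. 1 \<le> h d * l"
    using ge_d unfolding eventually_at_right_field by (auto intro: exI[of _ 1])
  ultimately have ge: "1 \<le> h 0 * l" by (rule tendsto_lowerbound) simp
  have le_d: "h 0 * f d \<le> 1" if d: "d > 0" for d
  proof (rule LIMSEQ_le_const2)
    show "(\<lambda>n. h 0 * f d * (1 - inverse (real (Suc n)) / d)) \<longlonglongrightarrow> h 0 * f d"
      using tendsto_mult[OF tendsto_const tendsto_diff[OF tendsto_const
            tendsto_divide[OF LIMSEQ_inverse_real_of_nat tendsto_const]], of d "h 0 * f d" 1] d by simp
    show "\<exists>N. \<forall>n\<ge>N. h 0 * f d * (1 - inverse (real (Suc n)) / d) \<le> 1"
    proof (intro exI[of _ 0] allI impI)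
      fix n
      define p where "p = real (Suc n)"
      have p: "p > 0" by (simp add: p_def)
      have h0: "h 0 \<ge> 0" using bernstein_nonneg[OF h, of 0] by simp
      have fd: "f d \<ge> 0" by (rule completely_monotone_nonneg[OF f d])
      have "p * d \<le> exp (p * d)" using exp_ge_add_one_self[of "p * d"] by linarith
      then have "exp (- p * d) \<le> inverse p / d"
        using p d by (simp add: exp_minus field_simps)
      then have "h 0 * f d * (1 - inverse p / d) \<le> h 0 * f d * (1 - exp (- p * d))"
        using h0 fd by (intro mult_left_mono) auto
      also have "\<dots> \<le> h 0 * (p * laplace f p)"
        unfolding mult.assoc by (intro mult_left_mono laplace_lower_bound[OF f L[OF p] p d] h0)
      also have "\<dots> \<le> (1 / (p * laplace f p)) * (p * laplace f p)"
        using bernstein_le_laplace[OF h p, of 0] eq[OF p] p by (intro mult_right_mono) auto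
      also have "\<dots> = 1" using eq[OF p] p by simp
      finally show "h 0 * f d * (1 - inverse (real (Suc n)) / d) \<le> 1" by (simp add: p_def)
    qed
  qed
  have "h 0 * l \<le> 1"
  proof (rule ccontr)
    assume "\<not> h 0 * l \<le> 1"
    moreover from this have "h 0 > 0" using l0 bernstein_nonneg[OF h, of 0] by (cases "h 0 = 0") auto
    ultimately have "1 / h 0 < l" by (simp add: field_simps)
    then obtain t where t: "t > 0" "1 / h 0 < f t" using sup by blast
    then show False using le_d[OF t(1)] \<open>h 0 > 0\<close> by (simp add: field_simps)
  qed
  then have "h 0 * l = 1" using ge by simp
  then show ?thesis using l0 by (simp add: field_simps)
qed

text \<open>
  Every upper bound \<open>H\<close> of \<open>h\<close> also bounds \<open>p * laplace h p\<close>, so \<open>1 \<le> H * p * (laplace f p + \<beta>)\<close>, where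
  the factor after \<open>H\<close> is at most \<open>f T\<close> in the limit \<open>p \<rightarrow> 0\<close>, for every \<open>T > 0\<close>.  For \<open>l > 0\<close> this bounds the supremum of \<open>h\<close> from below,
  and for \<open>l = 0\<close> it excludes an upper bound.
\<close>

lemma bernstein_bound_at_infinity:
  assumes h: "bernstein h" and f: "completely_monotone f" and L: "\<And>p. p > 0 \<Longrightarrow> laplace_exists f p"
    and \<beta>: "\<beta> \<ge> 0"
    and eq: "\<And>p. p > 0 \<Longrightarrow> laplace f p > 0 \<and> p * laplace h p = 1 / (p * (laplace f p + \<beta>))"
    and lim: "(f \<longlongrightarrow> l) at_top" and H: "\<And>t. t > 0 \<Longrightarrow> h t \<le> H"
  shows "1 \<le> H * l"
proof -
  have H0: "H \<ge> 0" using H[of 1] bernstein_nonneg[OF h, of 1] by simp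
  have T: "1 \<le> H * f T" if T: "T > 0" for T
  proof (rule LIMSEQ_le_const)
    let ?p = "\<lambda>n. inverse (real (Suc n))"
    let ?B = "\<lambda>p. H * (f T + p * (exp T * laplace f 1) + p * \<beta>)"
    have "(\<lambda>n. ?B (?p n)) \<longlonglongrightarrow> H * (f T + 0 * (exp T * laplace f 1) + 0 * \<beta>)"
      by (intro tendsto_intros LIMSEQ_inverse_real_of_nat)
    then show "(\<lambda>n. ?B (?p n)) \<longlonglongrightarrow> H * f T" by simp
    show "\<exists>N. \<forall>n\<ge>N. 1 \<le> ?B (?p n)"
    proof (intro exI[of _ 0] allI impI)
      fix n
      define p where "p = ?p n"
      have p: "p > 0" by (simp add: p_def)
      have pos: "p * (laplace f p + \<beta>) > 0" using eq[OF p] \<beta> p by (simp add: add_pos_nonneg)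
      have "1 = (p * laplace h p) * (p * (laplace f p + \<beta>))"
        unfolding conjunct2[OF eq[OF p]] using less_imp_neq[OF pos]
        by (simp only: times_divide_eq_left mult_1 divide_self)
      also have "\<dots> \<le> H * (p * (laplace f p + \<beta>))"
        using pos laplace_le_bound[OF bernstein_laplace_exists[OF h p] p H]
        by (intro mult_right_mono) auto
      also have "\<dots> \<le> ?B p"
        using laplace_small_argument_bound[OF f L[OF p] L[of 1] p T] H0
        by (intro mult_left_mono) (auto simp: algebra_simps)
      finally show "1 \<le> ?B (?p n)" by (simp add: p_def)
    qed
  qed
  have "((\<lambda>T. H * f T) \<longlongrightarrow> H * l) at_top" by (intro tendsto_intros lim)
  moreover have "\<forall>\<^sub>F T in at_top. 1 \<le> H * f T"
    using T by (intro eventually_at_top_linorderI[of 1]) auto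
  ultimately show ?thesis by (rule tendsto_lowerbound) simp
qed

lemma bernstein_limit_at_infinity:
  assumes h: "bernstein h" and f: "completely_monotone f" and L: "\<And>p. p > 0 \<Longrightarrow> laplace_exists f p"
    and \<beta>: "\<beta> \<ge> 0"
    and eq: "\<And>p. p > 0 \<Longrightarrow> laplace f p > 0 \<and> p * laplace h p = 1 / (p * (laplace f p + \<beta>))"
    and lim: "(f \<longlongrightarrow> l) at_top" and l: "l > 0" "\<And>t. t > 0 \<Longrightarrow> l \<le> f t"
  shows "(h \<longlongrightarrow> 1 / l) at_top"
proof -
  have upper: "h T \<le> 1 / l" if T: "T > 0" for T
  proof -
    have "h T * l \<le> 1"
    proof (rule LIMSEQ_le_const2)
      have "(\<lambda>n. h T * exp (- inverse (real (Suc n)) * T) * l) \<longlonglongrightarrow> h T * exp (- 0 * T) * l"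
        by (intro tendsto_intros LIMSEQ_inverse_real_of_nat)
      then show "(\<lambda>n. h T * exp (- inverse (real (Suc n)) * T) * l) \<longlonglongrightarrow> h T * l" by simp
      show "\<exists>N. \<forall>n\<ge>N. h T * exp (- inverse (real (Suc n)) * T) * l \<le> 1"
      proof (intro exI[of _ 0] allI impI)
        fix n
        define p where "p = inverse (real (Suc n))"
        have p: "p > 0" by (simp add: p_def)
        have pos: "p * (laplace f p + \<beta>) > 0" using eq[OF p] \<beta> p by (simp add: add_pos_nonneg)
        have "l \<le> p * laplace f p" by (rule laplace_ge_bound[OF L[OF p] p l(2)])
        moreover have "p * \<beta> \<ge> 0" using \<beta> p by simp
        ultimately have u: "l \<le> p * (laplace f p + \<beta>)" by (simp add: distrib_left)
        have "h T * exp (- p * T) * l \<le> (p * laplace h p) * (p * (laplace f p + \<beta>))"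
        proof (rule mult_mono[OF bernstein_le_laplace[OF h p] u])
          show "0 \<le> p * laplace h p" using eq[OF p] pos by (simp only: zero_le_divide_1_iff less_imp_le)
        qed (use T l(1) in auto)
        also have "\<dots> = 1"
          unfolding conjunct2[OF eq[OF p]] using less_imp_neq[OF pos]
          by (simp only: times_divide_eq_left mult_1 divide_self)
        finally show "h T * exp (- inverse (real (Suc n)) * T) * l \<le> 1" by (simp add: p_def)
      qed
    qed
    then show ?thesis using l(1) by (simp add: field_simps)
  qed
  show ?thesis
  proof (rule order_tendstoI)
    fix c assume c: "c < 1 / l"
    have "\<exists>T>0. c < h T"
    proof (rule ccontr)
      assume "\<not> (\<exists>T>0. c < h T)"
      then have bound: "h T \<le> c" if "T > 0" for T using that by force
      have "1 \<le> c * l" by (rule bernstein_bound_at_infinity[OF h f L \<beta> eq lim bound])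
      then show False using c l(1) by (simp add: field_simps)
    qed
    then obtain T where T: "T > 0" "c < h T" by blast
    have "c < h t" if "t \<ge> T" for t using bernstein_mono[OF h, of T t] T that by linarith
    then show "\<forall>\<^sub>F t in at_top. c < h t" by (rule eventually_at_top_linorderI)
  next
    fix c assume c: "1 / l < c"
    have "h t < c" if "t \<ge> 1" for t using upper[of t] c that by linarith
    then show "\<forall>\<^sub>F t in at_top. h t < c" by (rule eventually_at_top_linorderI)
  qed
qed

lemma bernstein_diverges_at_infinity:
  assumes h: "bernstein h" and f: "completely_monotone f" and L: "\<And>p. p > 0 \<Longrightarrow> laplace_exists f p"
    and \<beta>: "\<beta> \<ge> 0"
    and eq: "\<And>p. p > 0 \<Longrightarrow> laplace f p > 0 \<and> p * laplace h p = 1 / (p * (laplace f p + \<beta>))"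
    and lim: "(f \<longlongrightarrow> 0) at_top"
  shows "filterlim h at_top at_top"
  unfolding filterlim_at_top
proof
  fix H
  have "\<exists>T>0. H < h T"
  proof (rule ccontr)
    assume "\<not> (\<exists>T>0. H < h T)"
    then have bound: "h T \<le> H" if "T > 0" for T using that by force
    have "1 \<le> H * 0" by (rule bernstein_bound_at_infinity[OF h f L \<beta> eq lim bound])
    then show False by simp
  qed
  then obtain T where T: "T > 0" "H < h T" by blast
  have "H \<le> h t" if "t \<ge> T" for t using bernstein_mono[OF h, of T t] T that by linarith
  then show "\<forall>\<^sub>F t in at_top. H \<le> h t" by (rule eventually_at_top_linorderI)
qed

theorem theorem1:
  fixes f0 :: "real \<Rightarrow> real" and \<beta> :: real
  assumes "licm f0"
    and "\<exists>t>0. f0 t \<noteq> 0"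
    and "\<beta> \<ge> 0"
  shows "\<exists>h. bernstein h \<and>
    (\<forall>p>0. laplace_exists f0 p \<and> laplace_exists h p \<and>
       p * kernel_laplace (Conv_Kernel f0 \<beta>) p \<noteq> 0 \<and>
       1 / (p * kernel_laplace (Conv_Kernel f0 \<beta>) p) = p * laplace h p) \<and>
    (((\<lambda>t. ereal (f0 t)) \<longlongrightarrow> value_at_0 f0) (at_right 0) \<and>
     0 < value_at_0 f0 \<and> value_at_0 f0 \<le> \<infinity> \<and>
     (if \<beta> > 0 \<or> value_at_0 f0 = \<infinity> then h 0 = 0
      else h 0 = 1 / real_of_ereal (value_at_0 f0))) \<and>
    (\<exists>f_inf::real. (f0 \<longlongrightarrow> f_inf) at_top \<and> f_inf \<ge> 0 \<and>
     (if f_inf > 0 then (h \<longlongrightarrow> 1 / f_inf) at_top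
      else filterlim h at_top at_top))"
proof -
  have cm: "completely_monotone f0" using assms(1) by (rule licm_completely_monotone)
  have L: "laplace_exists f0 p" if "p > 0" for p using assms(1) that by (rule licm_laplace_exists)
  obtain t0 where t0: "t0 > 0" "f0 t0 \<noteq> 0" using assms(2) by blast
  have Lpos: "laplace f0 p > 0" if "p > 0" for p by (rule laplace_pos[OF cm L[OF that] that t0])
  have upos: "p * (laplace f0 p + \<beta>) > 0" if "p > 0" for p
    using Lpos[OF that] assms(3) that by (simp add: add_pos_nonneg)
  obtain h where h: "bernstein h"
    and eq: "\<And>p. p > 0 \<Longrightarrow> p * laplace h p = 1 / (p * (laplace f0 p + \<beta>))"
    using bernstein_transform_reciprocal[OF assms(1) t0 assms(3)]
    unfolding bernstein_transform_def by blast
  have eq': "laplace f0 p > 0 \<and> p * laplace h p = 1 / (p * (laplace f0 p + \<beta>))" if "p > 0" for p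
    using Lpos[OF that] eq[OF that] by simp

  \<comment> \<open>The limit at 0 of the decreasing \<open>f0\<close> is its supremum, possibly infinite.\<close>
  define V where "V = (SUP t\<in>{0<..}. ereal (f0 t))"
  have limV: "((\<lambda>t. ereal (f0 t)) \<longlongrightarrow> V) (at_right 0)"
    unfolding V_def using completely_monotone_antimono[OF cm] by (rule antimono_tendsto_at_right)
  then have V: "value_at_0 f0 = V" unfolding value_at_0_def by (intro tendsto_Lim) auto
  have leV: "ereal (f0 t) \<le> V" if "t > 0" for t unfolding V_def using that by (intro SUP_upper) auto
  have "0 < f0 t0" using completely_monotone_nonneg[OF cm t0(1)] t0(2) by simp
  then have Vpos: "0 < V" using leV[OF t0(1)] by (metis ereal_less(2) less_le_trans)
  have h0: "if \<beta> > 0 \<or> V = \<infinity> then h 0 = 0 else h 0 = 1 / real_of_ereal V"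
  proof (cases "\<beta> > 0 \<or> V = \<infinity>")
    case True
    have "\<exists>p>0. K < p * (laplace f0 p + \<beta>)" for K
    proof (cases "\<beta> > 0")
      case b: True
      define p where "p = (\<bar>K\<bar> + 1) / \<beta>"
      have p: "p > 0" using b by (simp add: p_def)
      have "K < p * \<beta>" using b by (simp add: p_def)
      also have "\<dots> \<le> p * (laplace f0 p + \<beta>)" using p Lpos[OF p] by simp
      finally show ?thesis using p by blast
    next
      case False
      then have "ereal (2 * \<bar>K\<bar>) < V" using True by simp
      then obtain d where d: "d > 0" "2 * \<bar>K\<bar> < f0 d"
        unfolding V_def less_SUP_iff by auto
      \<comment> \<open>At \<open>p = 1 / d\<close> the lower bound loses the factor \<open>1 - exp (- 1)\<close>, which is at least one half.\<close>
      define p where "p = 1 / d"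
      have p: "p > 0" "p * d = 1" using d by (auto simp: p_def)
      have "exp (- (1::real)) \<le> 1 / 2"
        using exp_ge_add_one_self[of 1] by (simp add: exp_minus field_simps)
      then have "f0 d * (1 / 2) \<le> f0 d * (1 - exp (- p * d))"
        using d p by (intro mult_left_mono) auto
      also have "\<dots> \<le> p * laplace f0 p" by (rule laplace_lower_bound[OF cm L[OF p(1)] p(1) d(1)])
      also have "\<dots> \<le> p * (laplace f0 p + \<beta>)" using p assms(3) by simp
      finally have "K < p * (laplace f0 p + \<beta>)" using d by linarith
      then show ?thesis using p by blast
    qed
    then have "h 0 = 0"
      using upos eq by (intro bernstein_initial_value_zero[OF h, of "\<lambda>p. p * (laplace f0 p + \<beta>)"]) auto
    then show ?thesis using True by simp
  next
    case False
    then have b0: "\<beta> = 0" using assms(3) by simp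
    obtain l where l: "V = ereal l" using False Vpos by (cases V) auto
    have "h 0 = 1 / l"
    proof (rule bernstein_initial_value[OF h cm L])
      show "laplace f0 p > 0 \<and> p * laplace h p = 1 / (p * laplace f0 p)" if "p > 0" for p
        using eq'[OF that] b0 by simp
      show "f0 t \<le> l" if "t > 0" for t using leV[OF that] l by simp
      show "\<exists>t>0. c < f0 t" if "c < l" for c
      proof -
        have "ereal c < V" using that l by simp
        then show ?thesis unfolding V_def less_SUP_iff by auto
      qed
    qed
    then show ?thesis using False l by simp
  qed

  obtain f_inf where fi: "f_inf \<ge> 0" "(f0 \<longlongrightarrow> f_inf) at_top" "\<And>t. t > 0 \<Longrightarrow> f_inf \<le> f0 t"
    using antimono_tendsto_at_top[of f0, OF completely_monotone_antimono[OF cm] completely_monotone_nonneg[OF cm]]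
    by blast
  have hinf: "if f_inf > 0 then (h \<longlongrightarrow> 1 / f_inf) at_top else filterlim h at_top at_top"
  proof (cases "f_inf > 0")
    case True
    then show ?thesis
      using bernstein_limit_at_infinity[OF h cm L assms(3) eq' fi(2) _ fi(3)] by simp
  next
    case False
    then have "f_inf = 0" using fi(1) by simp
    then show ?thesis
      using bernstein_diverges_at_infinity[OF h cm L assms(3) eq'] fi(2) by simp
  qed
  have transform: "laplace_exists f0 p \<and> laplace_exists h p \<and>
       p * kernel_laplace (Conv_Kernel f0 \<beta>) p \<noteq> 0 \<and>
       1 / (p * kernel_laplace (Conv_Kernel f0 \<beta>) p) = p * laplace h p" if p: "p > 0" for p
    unfolding kernel_laplace.simps
    using L[OF p] bernstein_laplace_exists[OF h p] less_imp_neq[OF upos[OF p]] eq[OF p] by metis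
  show ?thesis
    unfolding V
  proof (intro exI[of _ h] conjI exI[of _ f_inf])
    show "bernstein h" by (rule h)
    show "V \<le> \<infinity>" by simp
  qed (use transform limV Vpos h0 hinf fi(1,2) in blast)+
qed

end
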